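(* Let $\rho=\lambda/\mu$, let $(s_k(t),1\le k\le d-1)$ be (the first component of) the unique solution of the generalized Skorohod problem associated to the matrix $P$ and the functional $h\mapsto G(h,\beta,\lambda)$ defined in the context, let $x_0(t)=\mu\int_0^t s_1(u)\,du$, $s_d(t)=\beta-x_0(t)$, $x_1(t)=s_1(t)$ and $x_k(t)=s_k(t)-s_{k-1}(t)$ for $2\le k\le d$. (1) Suppose $2\mu\beta<\lambda<d\mu\beta$ and let $p=\lfloor \rho/\beta\rfloor$. There exists a sequence $$0=t_d<t_{d-1}<\dots<t_{p+1}<t_p=\infty$$ such that, for all $l=d-1,d-2,\ldots,p$ and for $t_{l+1}\leq t\leq t_l$ ($t<\infty$), $$s_k(t)=0,\qquad 1\leq k\leq l-1,$$ $$s_l(t)=(l+1)\beta-\rho+\xi_{l,1}e^{-\mu t}+\sum_{i=l+2}^d\xi_{l,i}e^{-\mu i t},$$ $$s_k(t)=\beta\Big(1-\sum_{i=k+1}^d\alpha_{k,i}e^{-i\mu t}\Big),\qquad l+1\leq k\leq d,$$ where the constants are determined recursively by: for $p+1\le l\le d-1$, $$\alpha_{l,j}=\frac{l+1}{l+1-j}\,\alpha_{l+1,j}\ \ (l+1<j\le d),\qquad \alpha_{l,l+1}=e^{(l+1)\mu t_l}\Big(1-\frac{\rho}{l\beta}-\sum_{k=l+2}^d\alpha_{l,k}e^{-k\mu t_l}\Big),$$ and for $p\le l\le d-1$, $$\xi_{l,j}=\frac{\beta(l+1)}{j-1}\,\alpha_{l+1,j}\ \ (l+2\le j\le d),\qquad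 \xi_{l,1}=-\Big(\big((l+1)\beta-\rho\big)e^{\mu t_{l+1}}+\sum_{j=l+2}^d\xi_{l,j}e^{-\mu(j-1)t_{l+1}}\Big),$$ and, for $p+1\le l\le d-1$, $t_l$ is the unique solution $t$ of $s_l(t)=\lambda/(l\mu)$. (2) Suppose $\lambda>d\mu\beta$. Then $(x_1(t),\dots,x_d(t))=(0,\dots,0,\beta)$ for all $t\ge0$.
   Context: Here $\lambda,\mu,\beta>0$ are real numbers and $d\ge2$ is an integer. Functional $G$. For $h=(h_1,\dots,h_{d-1})\in\mathcal D(\mathbb{R}_+,\mathbb{R}^{d-1})$ (càdlàg functions), $\eta>0$ and $F\ge 0$, set $G(h,F,\eta)=(G_k(h,F,\eta),1\le k\le d-1)$, where for $1\le k\le d-2$ $$G_k(h,F,\eta)(t)=\mu\int_0^t\big((k+1)h_{k+1}(u)-(k+1)h_k(u)-h_1(u)\big)\,du-\eta t\,\mathbf 1_{\{k=1\}},$$ $$G_{d-1}(h,F,\eta)(t)=d\mu\int_0^t\Big[F-h_{d-1}(u)-\mu\int_0^u h_1(v)\,dv\Big]du-\mu\int_0^t h_1(u)\,du-\eta t\,\mathbf 1_{\{d=2\}}.$$ The matrix $P=(P_{ij},1\le i,j\le d-1)$ has $P_{i,i-1}=1$ for $2\le i\le d-1$ and all other entries equal to $0$. Generalized Skorohod problem. For $K\ge1$, a functional $G:\mathcal D(\mathbb{R}_+,\mathbb{R}^K)\to\mathcal D(\mathbb{R}_+,\mathbb{R}^K)$ and a non-negative $K\times K$ matrix $P$, a couple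 of functions $((X(t)),(R(t)))$ with values in $\mathbb{R}^K$ is a solution of the generalized Skorohod problem associated to $G$ and $P$ if: (1) $X(t)=G(X)(t)+(I-P)R(t)$ for all $t\ge0$; (2) $X_k(t)\ge0$ for all $t\ge0$ and $1\le k\le K$; (3) for $1\le k\le K$, $t\mapsto R_k(t)$ is non-decreasing, $R_k(0)=0$ and $\int_{\mathbb{R}_+}X_k(t)\,dR_k(t)=0$. Empty sums are $0$. *)

theory Defs
  imports "HOL-Analysis.Analysis"
begin

text \<open>
  Functions on \<open>\<real>\<^sub>+\<close> are total functions on the reals of which only the values at
  \<open>t \<ge> 0\<close> matter; a function with values in \<open>\<real>\<^sup>K\<close> is a family \<open>h k t\<close> of which only
  the components \<open>1 \<le> k \<le> K\<close> matter.
\<close>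

definition cadlag :: "(real \<Rightarrow> real) \<Rightarrow> bool" where
  "cadlag f \<longleftrightarrow>
     (\<forall>t\<ge>0. continuous (at_right t) f) \<and>
     (\<forall>t>0. \<exists>l. (f \<longlongrightarrow> l) (at_left t))"

text \<open>
  The measure \<open>dR\<^sub>k\<close> is the Stieltjes measure of \<open>R\<^sub>k\<close> extended by the constant
  \<open>R\<^sub>k(0) = 0\<close> to negative times, so it has no mass on \<open>(-\<infinity>, 0]\<close>. The integral is the
  one of non-negative functions, because the Bochner integral would be \<open>0\<close> for
  a non-integrable \<open>X\<^sub>k\<close>.
\<close>

definition gen_skorohod_solution ::
  "nat \<Rightarrow> ((nat \<Rightarrow> real \<Rightarrow> real) \<Rightarrow> nat \<Rightarrow> real \<Rightarrow> real) \<Rightarrow> (nat \<Rightarrow> nat \<Rightarrow> real)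
    \<Rightarrow> (nat \<Rightarrow> real \<Rightarrow> real) \<Rightarrow> (nat \<Rightarrow> real \<Rightarrow> real) \<Rightarrow> bool" where
  "gen_skorohod_solution K G P X R \<longleftrightarrow>
     (\<forall>k\<in>{1..K}. cadlag (X k) \<and> cadlag (R k)) \<and>
     (\<forall>t\<ge>0. \<forall>k\<in>{1..K}.
        X k t = G X k t + (\<Sum>j=1..K. ((if k = j then 1 else 0) - P k j) * R j t)) \<and>
     (\<forall>t\<ge>0. \<forall>k\<in>{1..K}. X k t \<ge> 0) \<and>
     (\<forall>k\<in>{1..K}. mono_on {0..} (R k) \<and> R k 0 = 0 \<and>
        (\<integral>\<^sup>+t\<in>{0..}. ennreal (X k t) \<partial>interval_measure (\<lambda>t. R k (max 0 t))) = 0)"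

definition G_functional ::
  "nat \<Rightarrow> real \<Rightarrow> (nat \<Rightarrow> real \<Rightarrow> real) \<Rightarrow> real \<Rightarrow> real \<Rightarrow> nat \<Rightarrow> real \<Rightarrow> real" where
  "G_functional d \<mu> h F \<eta> k t =
     (if k \<le> d - 2
      then \<mu> * integral {0..t} (\<lambda>u. real (k + 1) * h (k + 1) u - real (k + 1) * h k u - h 1 u)
             - \<eta> * t * (if k = 1 then 1 else 0)
      else real d * \<mu> * integral {0..t} (\<lambda>u. F - h (d - 1) u - \<mu> * integral {0..u} (h 1))
             - \<mu> * integral {0..t} (h 1)
             - \<eta> * t * (if d = 2 then 1 else 0))"

definition P_matrix :: "nat \<Rightarrow> nat \<Rightarrow> nat \<Rightarrow> real" where
  "P_matrix d i j = (if 2 \<le> i \<and> i \<le> d - 1 \<and> j = i - 1 then 1 else 0)"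

definition x_zero :: "real \<Rightarrow> (nat \<Rightarrow> real \<Rightarrow> real) \<Rightarrow> real \<Rightarrow> real" where
  "x_zero \<mu> s t = \<mu> * integral {0..t} (s 1)"

text \<open>The family \<open>s\<^sub>1, \<dots>, s\<^sub>d\<^sub>-\<^sub>1\<close> completed by \<open>s\<^sub>d = \<beta> - x\<^sub>0\<close>.\<close>

definition s_full :: "nat \<Rightarrow> real \<Rightarrow> real \<Rightarrow> (nat \<Rightarrow> real \<Rightarrow> real) \<Rightarrow> nat \<Rightarrow> real \<Rightarrow> real" where
  "s_full d \<mu> \<beta> s k t = (if k = d then \<beta> - x_zero \<mu> s t else s k t)"

definition x_comp :: "nat \<Rightarrow> real \<Rightarrow> real \<Rightarrow> (nat \<Rightarrow> real \<Rightarrow> real) \<Rightarrow> nat \<Rightarrow> real \<Rightarrow> real" where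
  "x_comp d \<mu> \<beta> s k t =
     (if k = 1 then s 1 t else s_full d \<mu> \<beta> s k t - s_full d \<mu> \<beta> s (k - 1) t)"

end

theory Submission
  imports Defs
begin

text \<open>
  The one-dimensional reflection map is Lipschitz in the supremum norm. Since \<open>P\<close> is strictly
  triangular, this makes the solution of the Skorohod problem unique by a Gronwall iteration, so it
  suffices to exhibit one solution. Pushing queue \<open>k\<close> at rate \<open>(\<lambda> - (k + 1) \<mu> s\<^sub>k\<^sub>+\<^sub>1)\<^sup>+\<close> turns the
  system into the scalar equations
  \<open>s\<^sub>k' = (k + 1) \<mu> (s\<^sub>k\<^sub>+\<^sub>1 - s\<^sub>k) + (\<lambda> - (k + 1) \<mu> s\<^sub>k\<^sub>+\<^sub>1)\<^sup>+ - (\<lambda> - k \<mu> s\<^sub>k)\<^sup>+\<close>,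
  which are solved downwards from \<open>s\<^sub>d = \<beta>\<close>: \<open>s\<^sub>l\<close> stays at \<open>0\<close> until \<open>s\<^sub>l\<^sub>+\<^sub>1\<close> reaches \<open>\<rho> / (l + 1)\<close>, then
  increases towards \<open>(l + 1) \<beta> - \<rho>\<close>, which exceeds \<open>\<rho> / l\<close> exactly when \<open>l > \<rho> / \<beta>\<close>, and after
  crossing \<open>\<rho> / l\<close> it increases towards \<open>\<beta>\<close>.
\<close>

subsection \<open>Reflection in dimension one and Stieltjes complementarity\<close>

text \<open>The components are coupled through \<open>s 1\<close>, which enters every drift and,
  through \<open>s d\<close>, the top of the chain. In both regimes of the theorem
  \<open>s 1\<close> never leaves \<open>0\<close>; then \<open>s d\<close> is the constant \<beta>
  and component \<open>k\<close> depends on component \<open>k + 1\<close> alone. The push rate is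
  forced: while \<open>s k = 0\<close>, the regulator \<open>R (k - 1)\<close> takes away the full
  rate \<open>lam\<close>, so staying at \<open>0\<close> costs exactly
  \<open>lam - (k + 1) * \<mu> * s (k + 1)\<close>, which is nonnegative until
  \<open>s (k + 1)\<close> reaches its threshold. The given solution satisfies a condition on a
  Stieltjes measure, while the candidate is made of explicit pieces. Uniqueness is therefore proved
  for a pathwise notion, \<open>flow_solution\<close>, that the given solution is shown to satisfy;
  no Stieltjes integral has to be evaluated for the candidate.\<close>

text \<open>
  Pathwise form of \<open>\<integral> X dR = 0\<close>; the second clause says that \<open>dR\<close> has no atom where \<open>X > 0\<close>.
\<close>

definition complementary :: "(real \<Rightarrow> real) \<Rightarrow> (real \<Rightarrow> real) \<Rightarrow> bool" where
  "complementary X R \<longleftrightarrow>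
     (\<forall>a b. 0 \<le> a \<longrightarrow> a \<le> b \<longrightarrow> (\<forall>u\<in>{a<..b}. X u > 0) \<longrightarrow> R b = R a) \<and>
     (\<forall>t>0. X t > 0 \<longrightarrow> (R \<longlongrightarrow> R t) (at_left t))"

text \<open>Wherever \<open>R - R' > c\<close>, the bound on \<open>Z - Z'\<close> gives
  \<open>X > X' \<ge> 0\<close>, so \<open>R\<close> is frozen there while \<open>R'\<close> can
  only grow. Hence \<open>R - R'\<close> cannot rise after the last time \<tau> at which it was at
  most \<open>c\<close>.\<close>

lemma reflection_comparison:
  fixes X X' Z Z' R R' :: "real \<Rightarrow> real"
  assumes "complementary X R" and mono': "mono_on {0..} R'"
    and init: "R 0 = 0" "R' 0 = 0"
    and X: "\<And>u. u \<in> {0..t} \<Longrightarrow> X u = Z u + R u"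
    and X': "\<And>u. u \<in> {0..t} \<Longrightarrow> X' u = Z' u + R' u"
    and nonneg: "\<And>u. u \<in> {0..t} \<Longrightarrow> X' u \<ge> 0"
    and close: "\<And>u. u \<in> {0..t} \<Longrightarrow> \<bar>Z u - Z' u\<bar> \<le> c"
    and t: "t \<ge> 0"
  shows "R t \<le> R' t + c"
proof (rule ccontr)
  assume far: "\<not> R t \<le> R' t + c"
  have c: "c \<ge> 0" using close[of 0] t by auto
  define A where "A = {u \<in> {0..t}. R u - R' u \<le> c}"
  define \<tau> where "\<tau> = Sup A"
  have 0: "0 \<in> A" using t c init by (auto simp: A_def)
  have bdd: "bdd_above A" by (auto simp: A_def bdd_above_def)
  have \<tau>0: "0 \<le> \<tau>" unfolding \<tau>_def using 0 bdd by (rule cSup_upper)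
  have \<tau>t: "\<tau> \<le> t" unfolding \<tau>_def using 0 by (intro cSup_least) (auto simp: A_def)
  have pos: "X u > 0" if "u \<in> {0..t}" "u \<notin> A" for u
    using that X[of u] X'[of u] nonneg[of u] close[of u] by (auto simp: A_def)
  have notA: "u \<notin> A" if "u > \<tau>" for u
    using that cSup_upper[OF _ bdd] unfolding \<tau>_def by force
  have "\<forall>u\<in>{\<tau><..t}. X u > 0"
  proof
    fix u assume "u \<in> {\<tau><..t}"
    then show "X u > 0" using \<tau>0 by (intro pos notA) auto
  qed
  then have Req: "R t = R \<tau>"
    using assms(1) \<tau>0 \<tau>t unfolding complementary_def by blast
  have R't: "R' \<tau> \<le> R' t" using mono' \<tau>0 \<tau>t by (auto simp: mono_on_def)
  show False
  proof (cases "\<tau> \<in> A")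
    case True
    then show False using Req R't far by (auto simp: A_def)
  next
    \<comment> \<open>The supremum is not attained. As \<open>X \<tau> > 0\<close>, \<open>R\<close>
      has no jump at \<tau> and already exceeds \<open>R' \<tau> + c\<close> just before \<tau>; but
      points of \<open>A\<close> accumulate there, and \<open>R'\<close> is monotone.\<close>
    case False
    then have "\<tau> > 0" using 0 \<tau>0 by (cases "\<tau> = 0") auto
    moreover have "X \<tau> > 0" by (rule pos) (use False \<tau>0 \<tau>t in auto)
    ultimately have lim: "(R \<longlongrightarrow> R \<tau>) (at_left \<tau>)"
      using assms(1) by (auto simp: complementary_def)
    have "R' \<tau> + c < R \<tau>" using False \<tau>0 \<tau>t by (auto simp: A_def)
    then have "\<forall>\<^sub>F u in at_left \<tau>. R' \<tau> + c < R u" using lim by (rule order_tendstoD(1)[rotated])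
    then obtain b where b: "b < \<tau>" "\<And>u. b < u \<Longrightarrow> u < \<tau> \<Longrightarrow> R' \<tau> + c < R u"
      unfolding eventually_at_left_field by auto
    obtain a where a: "a \<in> A" "b < a"
      using b(1) less_cSup_iff[of A b] 0 bdd unfolding \<tau>_def by auto
    have "a < \<tau>" using a(1) False notA[of a] by (cases a \<tau> rule: linorder_cases) auto
    then have "R' \<tau> + c < R a" using b a by auto
    moreover have "R' a \<le> R' \<tau>" using mono' \<open>a < \<tau>\<close> \<tau>0 a by (auto simp: mono_on_def A_def)
    ultimately show False using a by (auto simp: A_def)
  qed
qed

section \<open>Pathwise content of a vanishing Stieltjes integral\<close>

text \<open>\<open>g n x\<close> is the first point of the grid of mesh \<open>1 / Suc n\<close>
  strictly to the right of \<open>x\<close>. Strictness makes it converge in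
  \<open>at_right x\<close>, and \<open>f\<close> composed with \<open>g n\<close> depends only on
  an integer-valued measurable function.\<close>

lemma right_continuous_borel_measurable:
  fixes f :: "real \<Rightarrow> real"
  assumes "\<And>x. continuous (at_right x) f"
  shows "f \<in> borel_measurable borel"
proof (rule borel_measurable_LIMSEQ_real)
  define g :: "nat \<Rightarrow> real \<Rightarrow> real" where
    "g n x = (real_of_int \<lfloor>real (Suc n) * x\<rfloor> + 1) / real (Suc n)" for n x
  have gt: "x < g n x" and le: "g n x \<le> x + 1 / real (Suc n)" for n x
  proof -
    define m where "m = real (Suc n)"
    have m: "m > 0" by (simp add: m_def)
    have "m * x < real_of_int \<lfloor>m * x\<rfloor> + 1" by linarith
    then show "x < g n x" unfolding g_def m_def[symmetric] using m by (simp add: field_simps)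
    have "real_of_int \<lfloor>m * x\<rfloor> \<le> m * x" by linarith
    then show "g n x \<le> x + 1 / real (Suc n)"
      unfolding g_def m_def[symmetric] using m by (simp add: field_simps)
  qed
  show "(\<lambda>n. f (g n x)) \<longlonglongrightarrow> f x" for x
  proof -
    have "(\<lambda>n. x + 1 / real (Suc n)) \<longlonglongrightarrow> x + 0"
      by (intro tendsto_intros LIMSEQ_Suc lim_1_over_n)
    then have "(\<lambda>n. g n x) \<longlonglongrightarrow> x"
      using tendsto_sandwich[of "\<lambda>_. x" "\<lambda>n. g n x" sequentially "\<lambda>n. x + 1 / real (Suc n)" x] gt le
      by (auto intro: less_imp_le eventuallyI)
    then have "filterlim (\<lambda>n. g n x) (at_right x) sequentially"
      using gt by (auto simp: filterlim_at intro!: eventuallyI simp: less_imp_neq[symmetric])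
    moreover have "(f \<longlongrightarrow> f x) (at_right x)"
      using assms[of x] by (simp add: continuous_within)
    ultimately show ?thesis by (rule filterlim_compose[rotated])
  qed
  show "(\<lambda>x. f (g n x)) \<in> borel_measurable borel" for n
  proof -
    have "(\<lambda>i::int. f ((real_of_int i + 1) / real (Suc n))) \<in> count_space UNIV \<rightarrow>\<^sub>M borel" by simp
    moreover have "(\<lambda>x::real. \<lfloor>real (Suc n) * x\<rfloor>) \<in> borel \<rightarrow>\<^sub>M count_space UNIV" by measurable
    ultimately show ?thesis unfolding g_def by (rule measurable_compose[rotated])
  qed
qed

lemma cadlag_extend_right_continuous:
  assumes "cadlag f"
  shows "continuous (at_right x) (\<lambda>t. f (max 0 t))"
proof (cases "x \<ge> 0")
  case True
  then have "continuous (at_right x) f" using assms by (auto simp: cadlag_def)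
  then show ?thesis using True
    unfolding continuous_within
    by (auto elim!: Lim_transform_eventually simp: eventually_at_filter max_def)
next
  case False
  then have ev: "\<forall>\<^sub>F t in at_right x. f 0 = f (max 0 t)"
    unfolding eventually_at_right_field by (intro exI[of _ 0]) (auto simp: max_def)
  have "((\<lambda>t. f 0) \<longlongrightarrow> f 0) (at_right x)" by simp
  then have "((\<lambda>t. f (max 0 t)) \<longlongrightarrow> f 0) (at_right x)"
    using ev by (rule Lim_transform_eventually)
  then show ?thesis using False unfolding continuous_within by (auto simp: max_def)
qed

text \<open>A vanishing integral makes every Borel set on which \<open>X > 0\<close> a null set of
  \<open>dR\<close>. An interval \<open>{a<..b}\<close> of this kind has mass
  \<open>R b - R a\<close>, which gives the first clause; a point \<open>{t}\<close> has as mass the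
  jump of \<open>R\<close>, which gives the second.\<close>

lemma stieltjes_complementary:
  assumes X: "cadlag X" and R: "cadlag R" and mono: "mono_on {0..} R"
    and int: "(\<integral>\<^sup>+t\<in>{0..}. ennreal (X t) \<partial>interval_measure (\<lambda>t. R (max 0 t))) = 0"
  shows "complementary X R"
proof -
  define F where "F = (\<lambda>t. R (max 0 t))"
  define M where "M = interval_measure F"
  have Fmono: "F x \<le> F y" if "x \<le> y" for x y
    using mono that by (auto simp: F_def mono_on_def)
  have Fright: "continuous (at_right x) F" for x
    unfolding F_def using R by (rule cadlag_extend_right_continuous)
  have [simp]: "sets M = sets borel" by (simp add: M_def)
  have Ioc: "emeasure M {a<..b} = ennreal (F b - F a)" if "a \<le> b" for a b
    unfolding M_def by (rule emeasure_interval_measure_Ioc) (use that Fmono Fright in auto)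
  \<comment> \<open>Nothing is known about \<open>X\<close> before time \<open>0\<close>, so
    measurability is shown for the version frozen at \<open>X 0\<close>, which agrees with
    \<open>X\<close> on the domain of integration.\<close>
  have [measurable]: "(\<lambda>t. X (max 0 t)) \<in> borel_measurable borel"
    by (intro right_continuous_borel_measurable cadlag_extend_right_continuous X)
  have "(\<lambda>t. ennreal (X (max 0 t)) * indicator {0..} t) \<in> borel_measurable M"
    unfolding M_def by measurable
  moreover have "(\<lambda>t. ennreal (X (max 0 t)) * indicator {0..} t) = (\<lambda>t. ennreal (X t) * indicator {0..} t)"
    by (auto simp: fun_eq_iff indicator_def)
  ultimately have ae: "AE t in M. ennreal (X t) * indicator {0..} t = 0"
    using int nn_integral_0_iff_AE unfolding M_def F_def by metis
  have null: "emeasure M A = 0" if "A \<in> sets borel" "\<And>t. t \<in> A \<Longrightarrow> t \<ge> 0 \<and> X t > 0" for A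
  proof -
    have "AE t in M. t \<notin> A" using ae
    proof eventually_elim
      case (elim t)
      then show ?case using that(2)[of t] by (auto simp: indicator_def)
    qed
    then show ?thesis using that(1) by (subst (asm) AE_iff_measurable[where N=A]) (auto simp: M_def)
  qed
  show ?thesis unfolding complementary_def
  proof (intro conjI allI impI)
    fix a b :: real assume ab: "0 \<le> a" "a \<le> b" and pos: "\<forall>u\<in>{a<..b}. X u > 0"
    have "emeasure M {a<..b} = 0" using ab pos by (intro null) auto
    then have "F b \<le> F a" using Ioc[OF ab(2)] by (simp add: ennreal_eq_0_iff)
    then show "R b = R a" using Fmono[OF ab(2)] ab by (simp add: F_def)
  next
    fix t :: real assume t: "t > 0" "X t > 0"
    define A where "A n = {t - 1 / real (Suc n)<..t}" for n
    have "(\<lambda>n. emeasure M (A n)) \<longlonglongrightarrow> emeasure M (\<Inter>n. A n)"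
    proof (rule Lim_emeasure_decseq)
      show "range A \<subseteq> sets M" by (auto simp: A_def)
      show "decseq A" unfolding decseq_def A_def
      proof (intro allI impI)
        fix m n :: nat assume "m \<le> n"
        then have "1 / real (Suc n) \<le> 1 / real (Suc m)" by (intro frac_le) auto
        then show "{t - 1 / real (Suc n)<..t} \<subseteq> {t - 1 / real (Suc m)<..t}" by auto
      qed
      show "emeasure M (A n) \<noteq> \<infinity>" for n unfolding A_def by (subst Ioc) auto
    qed
    moreover have "(\<Inter>n. A n) = {t}"
    proof (intro equalityI subsetI)
      fix x assume x: "x \<in> (\<Inter>n. A n)"
      have "x = t"
      proof (rule ccontr)
        assume "x \<noteq> t"
        then have "x < t" using x by (auto simp: A_def)
        then obtain n where "1 / real (Suc n) < t - x" using nat_approx_posE[of "t - x"] by auto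
        moreover have "x > t - 1 / real (Suc n)" using x by (auto simp: A_def)
        ultimately show False by linarith
      qed
      then show "x \<in> {t}" by simp
    qed (auto simp: A_def)
    moreover have "emeasure M {t} = 0" using t by (intro null) auto
    ultimately have "(\<lambda>n. ennreal (F t - F (t - 1 / real (Suc n)))) \<longlonglongrightarrow> ennreal 0"
      unfolding A_def by (simp add: Ioc)
    then have lim: "(\<lambda>n. F t - F (t - 1 / real (Suc n))) \<longlonglongrightarrow> 0"
      by (subst (asm) tendsto_ennreal_iff) (auto intro!: Fmono eventuallyI)
    have "(F \<longlongrightarrow> F t) (at_left t)"
    proof (rule order_tendstoI)
      fix y assume "y < F t"
      then have "\<forall>\<^sub>F n in sequentially. F t - F (t - 1 / real (Suc n)) < F t - y"
        using lim by (intro order_tendstoD) auto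
      then obtain n where n: "F t - F (t - 1 / real (Suc n)) < F t - y"
        by (auto simp: eventually_sequentially)
      show "\<forall>\<^sub>F x in at_left t. y < F x"
        unfolding eventually_at_left_field
      proof (intro exI[of _ "t - 1 / real (Suc n)"] conjI allI impI)
        fix x assume "t - 1 / real (Suc n) < x"
        then have "F (t - 1 / real (Suc n)) \<le> F x" by (intro Fmono) auto
        then show "y < F x" using n by linarith
      qed auto
    next
      fix y assume "F t < y"
      then have "F x < y" if "x < t" for x using Fmono[of x t] that by linarith
      then show "\<forall>\<^sub>F x in at_left t. F x < y"
        unfolding eventually_at_left_field by (intro exI[of _ "t - 1"]) auto
    qed
    then have "(F \<longlongrightarrow> R t) (at_left t)" using t by (simp add: F_def)
    then show "(R \<longlongrightarrow> R t) (at_left t)"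
      by (rule Lim_transform_eventually)
         (auto simp: F_def max_def eventually_at_left_field intro!: exI[of _ 0] t)
  qed
qed

section \<open>Boundedness and integrability of cadlag functions\<close>

text \<open>By bisection it suffices that approximants can be concatenated and exist on all short
  intervals around each point \<open>x\<close>. There a step function works, with the left limit as
  value before \<open>x\<close> and \<open>f x\<close> from \<open>x\<close> on.\<close>

lemma cadlag_approx:
  fixes f :: "real \<Rightarrow> real"
  assumes f: "cadlag f" and "T \<ge> 0" and e: "e > 0"
  obtains g where "g integrable_on {0..T}" "bounded (g ` {0..T})"
    "\<And>x. x \<in> {0..T} \<Longrightarrow> \<bar>f x - g x\<bar> \<le> e"
proof -
  define P where "P a b \<longleftrightarrow> (a \<ge> 0 \<longrightarrow> (\<exists>g. g integrable_on {a..b} \<and> bounded (g ` {a..b}) \<and>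
      (\<forall>x\<in>{a..b}. \<bar>f x - g x\<bar> \<le> e)))" for a b
  have "P 0 T" using \<open>T \<ge> 0\<close>
  proof (induction rule: Bolzano)
    case (trans a b c)
    show ?case unfolding P_def
    proof
      assume "a \<ge> 0"
      then have "b \<ge> 0" using trans by linarith
      obtain g where g: "g integrable_on {a..b}" "bounded (g ` {a..b})" "\<forall>x\<in>{a..b}. \<bar>f x - g x\<bar> \<le> e"
        using trans(1) \<open>a \<ge> 0\<close> unfolding P_def by auto
      obtain h where h: "h integrable_on {b..c}" "bounded (h ` {b..c})" "\<forall>x\<in>{b..c}. \<bar>f x - h x\<bar> \<le> e"
        using trans(2) \<open>b \<ge> 0\<close> unfolding P_def by auto
      define k where "k x = (if x \<le> b then g x else h x)" for x
      have "k integrable_on {a..b}" using g(1) by (rule integrable_eq) (auto simp: k_def)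
      moreover have "k integrable_on {b..c}"
        by (rule integrable_spike_finite[OF _ _ h(1), of "{b}"]) (auto simp: k_def)
      ultimately have "k integrable_on {a..c}" by (rule Henstock_Kurzweil_Integration.integrable_combine[OF trans(3,4)])
      moreover have "bounded (k ` {a..c})"
        by (rule bounded_subset[OF bounded_Un[THEN iffD2, OF conjI[OF g(2) h(2)]]])
           (auto simp: k_def)
      moreover have "\<forall>x\<in>{a..c}. \<bar>f x - k x\<bar> \<le> e" using g h by (auto simp: k_def)
      ultimately show "\<exists>g. g integrable_on {a..c} \<and> bounded (g ` {a..c}) \<and> (\<forall>x\<in>{a..c}. \<bar>f x - g x\<bar> \<le> e)"
        by blast
    qed
  next
    case (local x)
    then have x: "x \<ge> 0" by auto
    have "(f \<longlongrightarrow> f x) (at_right x)" using f x by (auto simp: cadlag_def continuous_within)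
    then have "\<forall>\<^sub>F u in at_right x. dist (f u) (f x) < e" using e by (rule tendstoD)
    then obtain r where r: "r > x" "\<And>u. x < u \<Longrightarrow> u < r \<Longrightarrow> \<bar>f u - f x\<bar> < e"
      unfolding eventually_at_right_field by (auto simp: dist_real_def)
    obtain l q where l: "q < x" "\<And>u. 0 \<le> u \<Longrightarrow> q < u \<Longrightarrow> u < x \<Longrightarrow> \<bar>f u - l\<bar> < e"
    \<comment> \<open>No time \<open>u \<ge> 0\<close> lies to the left of \<open>0\<close>, so any
      value serves as left limit there.\<close>
    proof (cases "x = 0")
      case True
      show ?thesis by (rule that[of "x - 1"]) (auto simp: True)
    next
      case False
      then have "x > 0" using x by simp
      then obtain l where "(f \<longlongrightarrow> l) (at_left x)" using f unfolding cadlag_def by blast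
      then have "\<forall>\<^sub>F u in at_left x. dist (f u) l < e" using e by (rule tendstoD)
      then obtain q where "q < x" "\<And>u. q < u \<Longrightarrow> u < x \<Longrightarrow> \<bar>f u - l\<bar> < e"
        unfolding eventually_at_left_field by (auto simp: dist_real_def)
      then show ?thesis using that by blast
    qed
    have "P a b" if ab: "a \<le> x" "x \<le> b" "b - a < min (r - x) (x - q)" for a b
      unfolding P_def
    proof
      assume a: "a \<ge> 0"
      define k where "k u = (if u < x then l else f x)" for u
      have "k integrable_on {a..x}"
        by (rule integrable_spike_finite[OF _ _ integrable_const_ivl[of l], of "{x}"]) (auto simp: k_def)
      moreover have "k integrable_on {x..b}"
        by (rule integrable_eq[OF integrable_const_ivl[of "f x"]]) (auto simp: k_def)
      ultimately have "k integrable_on {a..b}" by (rule Henstock_Kurzweil_Integration.integrable_combine[OF ab(1,2)])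
      moreover have "bounded (k ` {a..b})"
        by (rule bounded_subset[of "{l, f x}"]) (auto simp: k_def)
      moreover have "\<forall>u\<in>{a..b}. \<bar>f u - k u\<bar> \<le> e"
      proof
        fix u assume u: "u \<in> {a..b}"
        consider "u < x" | "u = x" | "u > x" by linarith
        then show "\<bar>f u - k u\<bar> \<le> e"
          using l(2)[of u] r(2)[of u] u ab a e by cases (auto simp: k_def)
      qed
      ultimately show "\<exists>g. g integrable_on {a..b} \<and> bounded (g ` {a..b}) \<and> (\<forall>x\<in>{a..b}. \<bar>f x - g x\<bar> \<le> e)"
        by blast
    qed
    moreover have "min (r - x) (x - q) > 0" using r l by auto
    ultimately show ?case by blast
  qed
  then show ?thesis using that unfolding P_def by auto
qed

lemma cadlag_bounded:
  assumes "cadlag f"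
  shows "bounded (f ` {0..T})"
proof (cases "T \<ge> 0")
  case True
  obtain g where g: "bounded (g ` {0..T})" "\<And>x. x \<in> {0..T} \<Longrightarrow> \<bar>f x - g x\<bar> \<le> 1"
    using cadlag_approx[OF assms True, of 1] zero_less_one by metis
  then obtain B where "\<And>x. x \<in> {0..T} \<Longrightarrow> \<bar>g x\<bar> \<le> B"
    unfolding bounded_iff real_norm_def by blast
  then have "\<bar>f x\<bar> \<le> B + 1" if "x \<in> {0..T}" for x using g(2)[OF that] that by fastforce
  then show ?thesis unfolding bounded_iff real_norm_def by blast
qed auto

lemma cadlag_integrable:
  assumes "cadlag f"
  shows "f integrable_on {0..T}"
proof (cases "T \<ge> 0")
  case True
  have "f integrable_on cbox 0 T"
  proof (rule integrable_uniform_limit)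
    fix e :: real assume "e > 0"
    then show "\<exists>g. (\<forall>x\<in>cbox 0 T. norm (f x - g x) \<le> e) \<and> g integrable_on cbox 0 T"
      unfolding cbox_interval real_norm_def using cadlag_approx[OF assms True] by metis
  qed
  then show ?thesis by simp
qed auto

subsection \<open>Uniqueness\<close>

text \<open>
  The last component \<open>s d\<close> and the arrivals \<open>R 0 t = lam * t\<close> are treated as one more queue and
  one more reflection term; then all components satisfy the same equation, including
  \<open>k = 1\<close> and \<open>k = d - 1\<close>.
\<close>

definition flow_solution ::
  "nat \<Rightarrow> real \<Rightarrow> real \<Rightarrow> real \<Rightarrow> (nat \<Rightarrow> real \<Rightarrow> real) \<Rightarrow> (nat \<Rightarrow> real \<Rightarrow> real) \<Rightarrow> bool" where
  "flow_solution d \<mu> \<beta> lam s R \<longleftrightarrow>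
     (\<forall>k\<in>{1..d}. \<forall>T. s k integrable_on {0..T} \<and> bounded (s k ` {0..T})) \<and>
     (\<forall>t\<ge>0. R 0 t = lam * t \<and> s d t = \<beta> - \<mu> * integral {0..t} (s 1)) \<and>
     (\<forall>k\<in>{1..d-1}. complementary (s k) (R k) \<and> mono_on {0..} (R k) \<and> R k 0 = 0 \<and>
        (\<forall>t\<ge>0. s k t \<ge> 0 \<and>
           s k t = \<mu> * integral {0..t} (\<lambda>u. real (k + 1) * (s (k + 1) u - s k u) - s 1 u)
                     + R k t - R (k - 1) t))"

text \<open>One Gronwall step: integration raises the power of time by one and gains the factor
  \<open>1 / Suc n\<close>, from which the factorial is built up.\<close>

lemma integral_monomial_bound:
  fixes f :: "real \<Rightarrow> real"
  assumes "f integrable_on {0..t}" "t \<ge> 0" "\<And>u. u \<in> {0..t} \<Longrightarrow> \<bar>f u\<bar> \<le> C * u ^ n"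
  shows "\<bar>integral {0..t} f\<bar> \<le> C * t ^ Suc n / real (Suc n)"
proof -
  have "((\<lambda>u. C * u ^ n) has_integral (C * t ^ Suc n / real (Suc n) - C * 0 ^ Suc n / real (Suc n))) {0..t}"
  proof (rule fundamental_theorem_of_calculus)
    fix x :: real
    have "((\<lambda>u. C * u ^ Suc n / real (Suc n)) has_real_derivative C * x ^ n) (at x within {0..t})"
      by (auto intro!: derivative_eq_intros simp del: power_Suc of_nat_Suc)
    then show "((\<lambda>u. C * u ^ Suc n / real (Suc n)) has_vector_derivative C * x ^ n) (at x within {0..t})"
      by (simp add: has_real_derivative_iff_has_vector_derivative)
  qed (use assms in auto)
  then have int: "((\<lambda>u. C * u ^ n) has_integral (C * t ^ Suc n / real (Suc n))) {0..t}" by simp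
  have "norm (integral {0..t} f) \<le> integral {0..t} (\<lambda>u. C * u ^ n)"
    by (rule integral_norm_bound_integral) (use assms int in \<open>auto simp: has_integral_iff\<close>)
  then show ?thesis unfolding integral_unique[OF int] by simp
qed

text \<open>
  Processing the components in increasing order of \<open>k\<close>, \<open>reflection_comparison\<close> with the regulator
  \<open>R (k - 1)\<close> as part of the input bounds the difference of two solutions by the sum of the
  differences of their drifts. Iterating this bound gives \<open>B * (L * t) ^ n / fact n\<close> for all \<open>n\<close>.
\<close>

lemma flow_solution_unique:
  assumes flow: "flow_solution d \<mu> \<beta> lam s R" "flow_solution d \<mu> \<beta> lam s' R'"
    and d: "d \<ge> 2" and \<mu>: "\<mu> > 0" and k: "k \<in> {1..d}" and t: "t \<ge> 0"
  shows "s k t = s' k t"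
proof -
  have int: "s k integrable_on {0..T}" "s' k integrable_on {0..T}"
    and bdd: "bounded (s k ` {0..T})" "bounded (s' k ` {0..T})" if "k \<in> {1..d}" for k T
    using flow that unfolding flow_solution_def by auto
  have R0: "R 0 t = R' 0 t"
    and sd: "s d t = \<beta> - \<mu> * integral {0..t} (s 1)" "s' d t = \<beta> - \<mu> * integral {0..t} (s' 1)"
    if "t \<ge> 0" for t
    using flow that unfolding flow_solution_def by auto
  define g where "g s k t = \<mu> * integral {0..t} (\<lambda>u. real (k + 1) * (s (k + 1) u - s k u) - s 1 u)"
    for s :: "nat \<Rightarrow> real \<Rightarrow> real" and k t
  have comp: "complementary (s k) (R k)" "complementary (s' k) (R' k)"
    and mono: "mono_on {0..} (R k)" "mono_on {0..} (R' k)"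
    and init: "R k 0 = 0" "R' k 0 = 0" if "k \<in> {1..d-1}" for k
    using flow that unfolding flow_solution_def by auto
  have nonneg: "s k t \<ge> 0" "s' k t \<ge> 0" if "k \<in> {1..d-1}" "t \<ge> 0" for k t
    using flow that unfolding flow_solution_def by blast+
  have eq: "s k t = (g s k t - R (k - 1) t) + R k t"
      "s' k t = (g s' k t - R' (k - 1) t) + R' k t" if "k \<in> {1..d-1}" "t \<ge> 0" for k t
  proof -
    have "s k t = g s k t + R k t - R (k - 1) t" "s' k t = g s' k t + R' k t - R' (k - 1) t"
      using flow that unfolding flow_solution_def g_def by blast+
    then show "s k t = (g s k t - R (k - 1) t) + R k t"
      "s' k t = (g s' k t - R' (k - 1) t) + R' k t" by linarith+
  qed
  define T where "T = t"
  have T: "T \<ge> 0" using t by (simp add: T_def)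
  have one: "1 \<in> {1..d}" using d by auto
  define \<Delta> where "\<Delta> k u = s k u - s' k u" for k u
  have \<Delta>int: "\<Delta> k integrable_on {0..T}" if "k \<in> {1..d}" for k T
    unfolding \<Delta>_def using int[OF that] by (intro integrable_diff)
  obtain B where B: "\<And>k u. k \<in> {1..d} \<Longrightarrow> u \<in> {0..T} \<Longrightarrow> \<bar>\<Delta> k u\<bar> \<le> B"
  proof -
    have "bounded (\<Union>k\<in>{1..d}. \<Delta> k ` {0..T})"
    proof (intro bounded_UN ballI)
      fix k assume k: "k \<in> {1..d}"
      then show "bounded (\<Delta> k ` {0..T})"
        unfolding \<Delta>_def using bounded_minus_comp[OF bdd[OF k]] by auto
    qed auto
    then obtain B where "\<forall>y\<in>(\<Union>k\<in>{1..d}. \<Delta> k ` {0..T}). norm y \<le> B" unfolding bounded_iff by blast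
    then have "\<bar>\<Delta> k u\<bar> \<le> B" if "k \<in> {1..d}" "u \<in> {0..T}" for k u
      unfolding real_norm_def using that by blast
    then show ?thesis by (rule that)
  qed
  \<comment> \<open>\<open>c / \<mu>\<close> bounds the integrand of a drift difference:
    \<open>real d\<close> covers the factor \<open>j + 1\<close>, \<open>1 + \<mu> * T\<close>
    allows for \<open>j + 1 = d\<close>, and \<open>real d + 1\<close> pays for the components
    \<open>j\<close> and \<open>1\<close>. The \<open>2 * d\<close> in \<open>L\<close> arises
    because component \<open>k\<close> collects one drift error and the errors of the regulators
    \<open>k\<close> and \<open>k - 1\<close>, in total
    \<open>1 + k + (k - 1) = 2 * k\<close>.\<close>
  define c where "c = \<mu> * (real d * (1 + \<mu> * T) + real d + 1)"
  define L where "L = 2 * real d * c"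
  have c: "c \<ge> 0" using \<mu> T by (simp add: c_def)
  have L: "L \<ge> 0" using c by (simp add: L_def)
  have B0: "B \<ge> 0" using B[OF one, of 0] T by auto
  have step: "\<bar>\<Delta> k t\<bar> \<le> C * L / real (Suc n) * t ^ Suc n"
    if IH: "\<And>k u. k \<in> {1..d-1} \<Longrightarrow> u \<in> {0..T} \<Longrightarrow> \<bar>\<Delta> k u\<bar> \<le> C * u ^ n"
      and k: "k \<in> {1..d-1}" and t: "t \<in> {0..T}" for C n k t
  proof -
    have C: "C * u ^ n \<ge> 0" if "u \<in> {0..T}" for u using IH[OF k that] by linarith
    \<comment> \<open>Component \<open>d\<close> is not reflected and lies outside the induction
      hypothesis; its difference is an integral of \<open>\<Delta> 1\<close>. Bounding the extra
      time factor by \<open>T\<close> keeps the power \<open>u ^ n\<close> common to all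
      components.\<close>
    have last: "\<bar>\<Delta> d u\<bar> \<le> \<mu> * T * (C * u ^ n)" if u: "u \<in> {0..T}" for u
    proof -
      have "\<Delta> d u = - \<mu> * integral {0..u} (\<Delta> 1)"
        unfolding \<Delta>_def using sd[of u] u int[OF one]
        by (subst integral_diff) (auto simp: algebra_simps)
      moreover have "\<bar>integral {0..u} (\<Delta> 1)\<bar> \<le> C * u ^ Suc n / real (Suc n)"
        by (rule integral_monomial_bound) (use IH d u \<Delta>int[OF one] in auto)
      moreover have "C * u ^ Suc n / real (Suc n) \<le> T * (C * u ^ n)"
      proof -
        have "C * u ^ Suc n / real (Suc n) \<le> (C * u ^ n) * u / 1"
          using mult_nonneg_nonneg[OF C[OF u], of u] u by (intro frac_le) (auto simp: mult_ac)
        also have "\<dots> \<le> T * (C * u ^ n)" using mult_right_mono[OF _ C[OF u], of u T] u by (simp only: mult.commute div_by_1 atLeastAtMost_iff)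
        finally show ?thesis .
      qed
      ultimately show ?thesis using \<mu> by (simp add: abs_mult mult.assoc)
    qed
    have all: "\<bar>\<Delta> k u\<bar> \<le> (1 + \<mu> * T) * (C * u ^ n)" if "k \<in> {1..d}" "u \<in> {0..T}" for k u
    proof (cases "k = d")
      case True
      then show ?thesis using last[OF that(2)] C[OF that(2)] by (simp add: algebra_simps)
    next
      case False
      then have "\<bar>\<Delta> k u\<bar> \<le> C * u ^ n" using that by (intro IH) auto
      moreover have "\<mu> * T * (C * u ^ n) \<ge> 0" using mult_nonneg_nonneg[OF _ C[OF that(2)], of "\<mu> * T"] \<mu> T by simp
      ultimately show ?thesis by (simp add: algebra_simps)
    qed
    define \<epsilon> where "\<epsilon> = c * C * t ^ Suc n / real (Suc n)"
    have \<epsilon>: "\<epsilon> \<ge> 0"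
      using C[OF t] c t mult_nonneg_nonneg[of c "C * t ^ n"] mult_nonneg_nonneg[of "c * (C * t ^ n)" t]
      unfolding \<epsilon>_def by (simp add: mult_ac)
    have drift: "\<bar>g s j u - g s' j u\<bar> \<le> \<epsilon>" if j: "j \<in> {1..d-1}" and u: "u \<in> {0..t}" for j u
    proof -
      have j': "j \<in> {1..d}" "j + 1 \<in> {1..d}" using j d by auto
      define w where "w v = real (j + 1) * (\<Delta> (j + 1) v - \<Delta> j v) - \<Delta> 1 v" for v
      have wint: "w integrable_on {0..u}" unfolding w_def
        by (intro integrable_diff integrable_on_mult_right \<Delta>int j' one)
      have "g s j u - g s' j u = \<mu> * integral {0..u} w"
      proof -
        have "integral {0..u} (\<lambda>v. real (j + 1) * (s (j + 1) v - s j v) - s 1 v)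
            - integral {0..u} (\<lambda>v. real (j + 1) * (s' (j + 1) v - s' j v) - s' 1 v)
            = integral {0..u} (\<lambda>v. (real (j + 1) * (s (j + 1) v - s j v) - s 1 v)
                 - (real (j + 1) * (s' (j + 1) v - s' j v) - s' 1 v))"
          by (rule integral_diff[symmetric])
             (intro integrable_diff integrable_on_mult_right int j' one)+
        also have "\<dots> = integral {0..u} w"
          by (rule integral_cong) (simp add: w_def \<Delta>_def algebra_simps)
        finally show ?thesis unfolding g_def by (simp add: right_diff_distrib[symmetric])
      qed
      moreover have "\<bar>integral {0..u} w\<bar> \<le> (c / \<mu> * C) * u ^ Suc n / real (Suc n)"
      proof (rule integral_monomial_bound[OF wint])
        fix v assume v: "v \<in> {0..u}"
        then have vT: "v \<in> {0..T}" using u t by auto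
        have "\<bar>w v\<bar> \<le> real (j + 1) * (\<bar>\<Delta> (j + 1) v\<bar> + \<bar>\<Delta> j v\<bar>) + \<bar>\<Delta> 1 v\<bar>"
          unfolding w_def using abs_triangle_ineq4[of "\<Delta> (j + 1) v" "\<Delta> j v"]
            abs_triangle_ineq4[of "real (j + 1) * (\<Delta> (j + 1) v - \<Delta> j v)" "\<Delta> 1 v"]
            mult_left_mono[OF abs_triangle_ineq4[of "\<Delta> (j + 1) v" "\<Delta> j v"] of_nat_0_le_iff[of "j + 1"]]
          by (simp only: abs_mult abs_of_nat)
        also have "\<dots> \<le> real d * ((1 + \<mu> * T) * (C * v ^ n) + C * v ^ n) + C * v ^ n"
        proof (intro add_mono mult_mono)
          show "\<bar>\<Delta> (j + 1) v\<bar> \<le> (1 + \<mu> * T) * (C * v ^ n)" by (rule all[OF j'(2) vT])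
        qed (use IH[OF _ vT] j d C[OF vT] in auto)
        also have "\<dots> = c / \<mu> * C * v ^ n" unfolding c_def using \<mu> by (simp add: field_simps)
        finally show "\<bar>w v\<bar> \<le> c / \<mu> * C * v ^ n" .
      qed (use u in auto)
      moreover have "(c / \<mu> * C) * u ^ Suc n / real (Suc n) \<le> \<epsilon> / \<mu>"
      proof -
        \<comment> \<open>\<open>C\<close> is arbitrary and only \<open>C * t ^ n \<ge> 0\<close> is
          known; this fixes its sign away from \<open>t = 0\<close>, where both sides of the
          estimate vanish.\<close>
        have "C \<ge> 0 \<or> t = 0"
        proof (cases "t = 0")
          case False
          then have "t ^ n > 0" using t by (intro zero_less_power) auto
          then have "C \<ge> 0" using C[OF t] mult_neg_pos[of C "t ^ n"] by linarith
          then show ?thesis ..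
        qed simp
        then have "C * u ^ Suc n \<le> C * t ^ Suc n"
        proof
          assume "C \<ge> 0"
          moreover have "u ^ Suc n \<le> t ^ Suc n" by (rule power_mono) (use u in auto)
          ultimately show ?thesis by (intro mult_left_mono)
        next
          assume "t = 0"
          then show ?thesis using u by simp
        qed
        then have "c / \<mu> / real (Suc n) * (C * u ^ Suc n) \<le> c / \<mu> / real (Suc n) * (C * t ^ Suc n)"
          by (rule mult_left_mono) (use c \<mu> in auto)
        then show ?thesis unfolding \<epsilon>_def by (simp add: mult_ac del: power_Suc)
      qed
      ultimately have "\<bar>g s j u - g s' j u\<bar> \<le> \<mu> * (\<epsilon> / \<mu>)"
        using \<mu> by (simp only: abs_mult abs_of_pos) (intro mult_left_mono, auto)
      then show ?thesis using \<mu> by simp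
    qed
    \<comment> \<open>Each queue inherits the error of the previous regulator and adds one drift
      error, hence the factor \<open>j\<close>. The chain starts without error because
      \<open>R 0\<close> is the same arrival process for both solutions.\<close>
    have push: "\<bar>R j u - R' j u\<bar> \<le> real j * \<epsilon>" if "j \<le> d - 1" "u \<in> {0..t}" for j u
      using that
    proof (induction j arbitrary: u)
      case 0
      then show ?case using R0 by auto
    next
      case (Suc j)
      then have j: "Suc j \<in> {1..d-1}" by auto
      have close: "\<bar>(g s (Suc j) v - R j v) - (g s' (Suc j) v - R' j v)\<bar> \<le> real (Suc j) * \<epsilon>"
        if "v \<in> {0..u}" for v
        using drift[OF j, of v] Suc.IH[of v] Suc.prems that by (auto simp: algebra_simps)
      have "R (Suc j) u \<le> R' (Suc j) u + real (Suc j) * \<epsilon>"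
        by (rule reflection_comparison[OF comp(1)[OF j] mono(2)[OF j] init[OF j],
              where X' = "s' (Suc j)" and Z = "\<lambda>v. g s (Suc j) v - R j v"
                and Z' = "\<lambda>v. g s' (Suc j) v - R' j v"])
           (use eq[OF j] nonneg[OF j] close Suc.prems in auto)
      moreover have "R' (Suc j) u \<le> R (Suc j) u + real (Suc j) * \<epsilon>"
        by (rule reflection_comparison[OF comp(2)[OF j] mono(1)[OF j] init(2,1)[OF j],
              where X' = "s (Suc j)" and Z' = "\<lambda>v. g s (Suc j) v - R j v"
                and Z = "\<lambda>v. g s' (Suc j) v - R' j v"])
           (use eq[OF j] nonneg[OF j] close Suc.prems in \<open>auto simp: abs_minus_commute\<close>)
      ultimately show ?case by linarith
    qed
    have "\<bar>\<Delta> k t\<bar> \<le> \<bar>g s k t - g s' k t\<bar> + \<bar>R k t - R' k t\<bar> + \<bar>R (k - 1) t - R' (k - 1) t\<bar>"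
    proof -
      have "t \<ge> 0" using t by simp
      then show ?thesis unfolding \<Delta>_def using eq[OF k, of t] by linarith
    qed
    also have "\<dots> \<le> \<epsilon> + real k * \<epsilon> + real (k - 1) * \<epsilon>"
    proof -
      have "k \<le> d - 1" "k - 1 \<le> d - 1" "t \<in> {0..t}" using k t by auto
      then show ?thesis using drift[OF k, of t] push[of k t] push[of "k - 1" t] by linarith
    qed
    also have "\<dots> = 2 * real k * \<epsilon>" using k by (simp add: of_nat_diff algebra_simps)
    also have "\<dots> \<le> 2 * real d * \<epsilon>" using k \<epsilon> by (intro mult_right_mono) auto
    also have "\<dots> = C * L / real (Suc n) * t ^ Suc n" by (simp add: \<epsilon>_def L_def mult_ac)
    finally show ?thesis .
  qed
  have bound: "\<bar>\<Delta> k u\<bar> \<le> B * L ^ n / fact n * u ^ n" if "k \<in> {1..d-1}" "u \<in> {0..T}" for k u n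
    using that
  proof (induction n arbitrary: k u)
    case 0
    then show ?case using B[of k u] by auto
  next
    case (Suc n)
    show ?case using step[of "B * L ^ n / fact n" n, OF Suc.IH Suc.prems]
      by (simp add: mult_ac)
  qed
  have zero: "\<Delta> k u = 0" if "k \<in> {1..d-1}" "u \<in> {0..T}" for k u
  proof -
    have "(\<lambda>n. (L * u) ^ n / fact n) \<longlonglongrightarrow> 0"
      using summable_LIMSEQ_zero[OF summable_exp[of "L * u"]] by (simp add: field_simps)
    then have "(\<lambda>n. B * ((L * u) ^ n / fact n)) \<longlonglongrightarrow> B * 0" by (rule tendsto_mult_left)
    moreover have "\<bar>\<Delta> k u\<bar> \<le> B * ((L * u) ^ n / fact n)" for n
      using bound[OF that, of n] by (simp add: power_mult_distrib mult_ac)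
    ultimately have "\<bar>\<Delta> k u\<bar> \<le> 0" using LIMSEQ_le_const by fastforce
    then show ?thesis by simp
  qed
  show ?thesis
  proof (cases "k = d")
    case True
    have "integral {0..t} (s 1) = integral {0..t} (s' 1)"
      by (rule integral_cong) (use zero[of 1] d in \<open>auto simp: \<Delta>_def T_def\<close>)
    then show ?thesis using sd[OF t] True by simp
  next
    case False
    then show ?thesis using zero[of k t] k t by (auto simp: \<Delta>_def T_def)
  qed
qed

section \<open>From the Skorohod problem to the flow system, and the candidate\<close>

text \<open>The boundary cases of \<open>G_functional\<close> are absorbed: the arrival term at
  \<open>k = 1\<close> becomes \<open>- R 0\<close>, and the double integral at
  \<open>k = d - 1\<close> is the general drift with \<open>s d\<close> written out. The subdiagonal
  \<open>P\<close> supplies \<open>- R (k - 1)\<close> for the other \<open>k\<close>.\<close>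

lemma skorohod_flow_solution:
  assumes sol: "gen_skorohod_solution (d - 1) (\<lambda>h. G_functional d \<mu> h \<beta> lam) (P_matrix d) S R"
    and d: "d \<ge> 2"
  shows "flow_solution d \<mu> \<beta> lam (s_full d \<mu> \<beta> S) (\<lambda>k t. if k = 0 then lam * t else R k t)"
proof -
  have cad: "cadlag (S k)" "cadlag (R k)" and mono: "mono_on {0..} (R k)" and R0: "R k 0 = 0"
    and int: "(\<integral>\<^sup>+t\<in>{0..}. ennreal (S k t) \<partial>interval_measure (\<lambda>t. R k (max 0 t))) = 0"
    and nonneg: "\<And>t. t \<ge> 0 \<Longrightarrow> S k t \<ge> 0"
    and eq: "\<And>t. t \<ge> 0 \<Longrightarrow> S k t = G_functional d \<mu> S \<beta> lam k t +
        (\<Sum>j=1..d-1. ((if k = j then 1 else 0) - P_matrix d k j) * R j t)"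
    if "k \<in> {1..d-1}" for k
    using sol that unfolding gen_skorohod_solution_def by blast+
  define s where "s = s_full d \<mu> \<beta> S"
  have s: "s k = S k" if "k \<noteq> d" for k using that by (auto simp: s_def s_full_def)
  have sd: "s d = (\<lambda>t. \<beta> - \<mu> * integral {0..t} (S 1))"
    by (auto simp: s_def s_full_def x_zero_def)
  have one: "1 \<in> {1..d-1}" "1 \<noteq> d" using d by auto
  have cont: "continuous_on {0..T} (s d)" for T
    unfolding sd by (intro continuous_intros indefinite_integral_continuous_1 cadlag_integrable cad one)
  have reg: "s k integrable_on {0..T}" "bounded (s k ` {0..T})" if "k \<in> {1..d}" for k T
  proof -
    have "s k integrable_on {0..T} \<and> bounded (s k ` {0..T})"
    proof (cases "k = d")
      case True
      then show ?thesis using cont[of T]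
        by (auto intro: integrable_continuous_interval compact_imp_bounded compact_continuous_image)
    next
      case False
      then have "cadlag (S k)" using that by (intro cad) auto
      then show ?thesis using s[OF False] by (simp add: cadlag_integrable cadlag_bounded)
    qed
    then show "s k integrable_on {0..T}" "bounded (s k ` {0..T})" by auto
  qed
  have push: "(\<Sum>j=1..d-1. ((if k = j then 1 else 0) - P_matrix d k j) * R j t)
      = R k t - (if k = 1 then 0 else R (k - 1) t)" if k: "k \<in> {1..d-1}" for k t
  proof -
    have "(\<Sum>j=1..d-1. ((if k = j then 1 else 0) - P_matrix d k j) * R j t)
        = (\<Sum>j=1..d-1. (if k = j then R j t else 0)) - (\<Sum>j=1..d-1. P_matrix d k j * R j t)"
      unfolding sum_subtractf[symmetric] by (rule sum.cong) (auto simp: algebra_simps)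
    also have "(\<Sum>j=1..d-1. (if k = j then R j t else 0)) = R k t" using k by simp
    also have "(\<Sum>j=1..d-1. P_matrix d k j * R j t) = (\<Sum>j=1..d-1. (if k - 1 = j then R j t else 0))"
      by (rule sum.cong) (use k in \<open>auto simp: P_matrix_def\<close>)
    also have "\<dots> = (if k = 1 then 0 else R (k - 1) t)" using k by auto
    finally show ?thesis .
  qed
  have main: "s k t = \<mu> * integral {0..t} (\<lambda>u. real (k + 1) * (s (k + 1) u - s k u) - s 1 u)
      + R k t - (if k = 1 then lam * t else R (k - 1) t)" if k: "k \<in> {1..d-1}" and t: "t \<ge> 0" for k t
  proof (cases "k \<le> d - 2")
    case True
    then have "s (k + 1) = S (k + 1)" "s k = S k" "s 1 = S 1" using k d s one by auto
    then show ?thesis using eq[OF k t] True unfolding push[OF k]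
      by (auto simp: G_functional_def right_diff_distrib)
  next
    case False
    then have kd: "k = d - 1" "k + 1 = d" "k \<noteq> d" using k d by auto
    have s1: "s 1 = S 1" using s one by auto
    have "integral {0..t} (\<lambda>u. real (k + 1) * (s (k + 1) u - s k u) - s 1 u)
       = integral {0..t} (\<lambda>u. real d * (s d u - s k u)) - integral {0..t} (s 1)"
      unfolding kd(2) by (intro integral_diff integrable_on_mult_right integrable_diff reg) (use k d in auto)
    also have "integral {0..t} (\<lambda>u. real d * (s d u - s k u)) = real d * integral {0..t} (\<lambda>u. s d u - s k u)"
      by simp
    also have "(\<lambda>u. s d u - s k u) = (\<lambda>u. \<beta> - S (d - 1) u - \<mu> * integral {0..u} (S 1))"
      using s[OF kd(3)] kd(1) by (auto simp: sd)
    finally have drift: "integral {0..t} (\<lambda>u. real (k + 1) * (s (k + 1) u - s k u) - s 1 u)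
      = real d * integral {0..t} (\<lambda>u. \<beta> - S (d - 1) u - \<mu> * integral {0..u} (S 1)) - integral {0..t} (s 1)" .
    have scale: "\<mu> * A = real d * \<mu> * I - \<mu> * J" if "A = real d * I - J" for A I J
      unfolding that by (simp add: algebra_simps)
    have "\<mu> * integral {0..t} (\<lambda>u. real (k + 1) * (s (k + 1) u - s k u) - s 1 u)
      = real d * \<mu> * integral {0..t} (\<lambda>u. \<beta> - S (d - 1) u - \<mu> * integral {0..u} (S 1))
          - \<mu> * integral {0..t} (S 1)"
      using scale[OF drift] unfolding s1 .
    \<comment> \<open>For \<open>d = 2\<close> the top component is also the first one, so the
      indicator of \<open>d = 2\<close> is its arrival term.\<close>
    moreover have "d = 2 \<longleftrightarrow> k = 1" using kd by auto
    ultimately show ?thesis using eq[OF k t] False unfolding push[OF k] s[OF kd(3)]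
      by (auto simp: G_functional_def kd(1)[symmetric])
  qed
  have comp: "complementary (s k) (R k)" if "k \<in> {1..d-1}" for k
    using stieltjes_complementary[OF cad[OF that] mono[OF that] int[OF that]] s[of k] that by auto
  show ?thesis unfolding flow_solution_def s_def[symmetric]
  proof (intro conjI ballI allI impI)
    fix k and t :: real assume k: "k \<in> {1..d-1}" and t: "t \<ge> 0"
    show "s k t = \<mu> * integral {0..t} (\<lambda>u. real (k + 1) * (s (k + 1) u - s k u) - s 1 u)
      + (if k = 0 then lam * t else R k t) - (if k - 1 = 0 then lam * t else R (k - 1) t)"
    proof -
      have "k \<noteq> 0" "k - 1 = 0 \<longleftrightarrow> k = 1" using k by auto
      then show ?thesis using main[OF k t] by simp
    qed
    show "s k t \<ge> 0" using nonneg[OF k t] s[of k] k by auto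
  next
    fix k assume k: "k \<in> {1..d-1}"
    then have [simp]: "k \<noteq> 0" by auto
    show "complementary (s k) (\<lambda>t. if k = 0 then lam * t else R k t)"
      "mono_on {0..} (\<lambda>t. if k = 0 then lam * t else R k t)"
      "(if k = 0 then lam * 0 else R k 0) = 0"
      using comp[OF k] mono[OF k] R0[OF k] by simp_all
  qed (use reg sd s[OF one(2)] in auto)
qed

text \<open>
  In the solution, queue \<open>k\<close> is pushed at rate \<open>(lam - (k + 1) * \<mu> * s (k + 1))\<^sup>+\<close>. This decouples
  the system: each component solves a scalar equation driven by the next one.
\<close>

lemma candidate_flow_solution:
  fixes C :: "nat \<Rightarrow> real \<Rightarrow> real"
  assumes d: "d \<ge> 2" and lam: "lam \<ge> 0"
    and cont: "\<And>k. k \<in> {1..d} \<Longrightarrow> continuous_on {0..} (C k)"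
    and first: "\<And>u. u \<ge> 0 \<Longrightarrow> C 1 u = 0"
    and last: "\<And>u. u \<ge> 0 \<Longrightarrow> C d u = \<beta>"
    and nonneg: "\<And>k u. k \<in> {1..d-1} \<Longrightarrow> u \<ge> 0 \<Longrightarrow> C k u \<ge> 0"
    and active: "\<And>k u. k \<in> {1..d-1} \<Longrightarrow> u \<ge> 0 \<Longrightarrow> C k u > 0 \<Longrightarrow> lam \<le> real (k + 1) * \<mu> * C (k + 1) u"
    and ode: "\<And>k t. k \<in> {1..d-1} \<Longrightarrow> t \<ge> 0 \<Longrightarrow>
      ((\<lambda>u. real (k + 1) * \<mu> * (C (k + 1) u - C k u) + max 0 (lam - real (k + 1) * \<mu> * C (k + 1) u)
           - max 0 (lam - real k * \<mu> * C k u)) has_integral C k t) {0..t}"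
  shows "flow_solution d \<mu> \<beta> lam C
    (\<lambda>k t. integral {0..t} (\<lambda>u. max 0 (lam - real (k + 1) * \<mu> * C (k + 1) u)))"
proof -
  define r where "r k u = max 0 (lam - real (k + 1) * \<mu> * C (k + 1) u)" for k u
  define R where "R k t = integral {0..t} (r k)" for k t
  have contT: "continuous_on {a..b} (C k)" if "k \<in> {1..d}" "a \<ge> 0" for k a b
    using cont[OF that(1)] by (rule continuous_on_subset) (use that in auto)
  have rcont: "continuous_on {a..b} (r k)" if "k \<le> d - 1" "a \<ge> 0" for k a b
    unfolding r_def using that d by (intro continuous_intros contT) auto
  have Rcont: "continuous_on {0..T} (R k)" if "k \<le> d - 1" for k T
    unfolding R_def by (intro indefinite_integral_continuous_1 integrable_continuous_interval rcont that) simp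
  have rint: "r k integrable_on {a..b}" if "k \<le> d - 1" "a \<ge> 0" for k a b
    using rcont[OF that] by (rule integrable_continuous_interval)
  have Radd: "R k b = R k a + integral {a..b} (r k)" if "k \<le> d - 1" "0 \<le> a" "a \<le> b" for k a b
    unfolding R_def using that rint by (intro Henstock_Kurzweil_Integration.integral_combine[symmetric]) auto
  have Rinit: "R k 0 = 0" for k by (simp add: R_def)
  have mono: "mono_on {0..} (R k)" if "k \<le> d - 1" for k
  proof (rule mono_onI)
    fix a b :: real assume ab: "a \<in> {0..}" "b \<in> {0..}" "a \<le> b"
    have "integral {a..b} (r k) \<ge> 0" using ab that by (intro integral_nonneg rint) (auto simp: r_def)
    then show "R k a \<le> R k b" using Radd[of k a b] that ab by auto
  qed
  have comp: "complementary (C k) (R k)" if k: "k \<in> {1..d-1}" for k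
    unfolding complementary_def
  proof (intro conjI allI impI)
    fix a b :: real assume ab: "0 \<le> a" "a \<le> b" and pos: "\<forall>u\<in>{a<..b}. C k u > 0"
    \<comment> \<open>Where \<open>C k > 0\<close>, the next component is above its threshold and
      the push rate vanishes. Positivity is unknown at the left end \<open>a\<close>, a null set for
      the integral.\<close>
    have "r k u = 0" if "u \<in> {a..b} - {a}" for u
      using active[OF k, of u] pos that ab by (auto simp: r_def)
    then have "integral {a..b} (r k) = integral {a..b} (\<lambda>_. 0)"
      by (intro integral_spike[of "{a}"]) auto
    then show "R k b = R k a" using Radd[of k a b] ab k by auto
  next
    fix t :: real assume t: "t > 0"
    show "(R k \<longlongrightarrow> R k t) (at_left t)"
      using continuous_on_Icc_at_leftD[OF Rcont[of k t] t] k by auto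
  qed
  \<comment> \<open>Since \<open>C 1 = 0\<close>, the general rate formula at index \<open>0\<close>
    reduces to the arrival rate \<open>lam\<close>.\<close>
  have zero: "R 0 t = lam * t" if "t \<ge> 0" for t
  proof -
    have "R 0 t = integral {0..t} (\<lambda>_. lam)"
      unfolding R_def by (rule integral_cong) (use first lam in \<open>auto simp: r_def\<close>)
    then show ?thesis using that by simp
  qed
  have C1: "integral {0..t} (C 1) = 0" for t
  proof -
    have "integral {0..t} (C 1) = integral {0..t} (\<lambda>_. 0)"
      by (rule integral_cong) (use first in auto)
    then show ?thesis by simp
  qed
  have main: "C k t = \<mu> * integral {0..t} (\<lambda>u. real (k + 1) * (C (k + 1) u - C k u) - C 1 u)
      + R k t - R (k - 1) t" if k: "k \<in> {1..d-1}" and t: "t \<ge> 0" for k t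
  proof -
    define w where "w u = real (k + 1) * (C (k + 1) u - C k u)" for u
    have wint: "w integrable_on {0..t}"
      unfolding w_def using k
      by (intro integrable_continuous_interval continuous_intros contT) auto
    have rk: "r (k - 1) u = max 0 (lam - real k * \<mu> * C k u)" for u
      using k by (simp add: r_def)
    have "((\<lambda>u. \<mu> * w u + r k u - r (k - 1) u) has_integral
        (\<mu> * integral {0..t} w + R k t - R (k - 1) t)) {0..t}"
      unfolding R_def using k
      by (intro has_integral_diff has_integral_add has_integral_mult_right integrable_integral wint rint) auto
    moreover have "((\<lambda>u. \<mu> * w u + r k u - r (k - 1) u) has_integral C k t) {0..t}"
      using ode[OF k t] unfolding rk by (simp add: w_def r_def mult_ac)
    ultimately have "C k t = \<mu> * integral {0..t} w + R k t - R (k - 1) t"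
      by (rule has_integral_unique[symmetric])
    moreover have "integral {0..t} w = integral {0..t} (\<lambda>u. real (k + 1) * (C (k + 1) u - C k u) - C 1 u)"
      by (rule integral_cong) (use first in \<open>auto simp: w_def\<close>)
    ultimately show ?thesis by simp
  qed
  have reg: "C k integrable_on {0..T}" "bounded (C k ` {0..T})" if "k \<in> {1..d}" for k T
    using contT[OF that, of 0 T]
    by (auto intro: integrable_continuous_interval compact_imp_bounded compact_continuous_image)
  have "flow_solution d \<mu> \<beta> lam C R"
    unfolding flow_solution_def
    by (intro conjI ballI allI impI)
       (use reg zero last C1 comp mono Rinit nonneg main in auto)
  then show ?thesis unfolding R_def r_def .
qed

subsection \<open>The explicit curves\<close>

text \<open>The integrating factor gives \<open>exp (c * u) * (y u - M)\<close> the derivative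
  \<open>exp (c * u) * c * (f u - M) \<le> 0\<close>. Being negative at \<open>T\<close>, it is
  negative at \<open>t\<close>, so strictness survives.\<close>

lemma relaxation_stays_below:
  fixes y f :: "real \<Rightarrow> real"
  assumes "c \<ge> 0" "T \<le> t"
    and y: "\<And>u. u \<in> {T..t} \<Longrightarrow> (y has_real_derivative c * (f u - y u)) (at u)"
    and f: "\<And>u. u \<in> {T..t} \<Longrightarrow> f u \<le> M"
    and start: "y T < M"
  shows "y t < M"
proof -
  define z where "z u = exp (c * u) * (y u - M)" for u
  have "z t \<le> z T"
  proof (rule DERIV_nonpos_imp_nonincreasing[OF \<open>T \<le> t\<close>])
    fix u assume u: "T \<le> u" "u \<le> t"
    have "(z has_real_derivative exp (c * u) * (c * (f u - M))) (at u)"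
      unfolding z_def using u by (auto intro!: derivative_eq_intros y simp: algebra_simps)
    moreover have "exp (c * u) * (c * (f u - M)) \<le> 0"
      using f[of u] u assms(1) by (auto intro!: mult_nonneg_nonpos)
    ultimately show "\<exists>D. (z has_real_derivative D) (at u) \<and> D \<le> 0" by blast
  qed
  also have "z T < 0" unfolding z_def using start by (intro mult_pos_neg) auto
  finally show ?thesis by (simp add: z_def mult_less_0_iff)
qed

lemma tendsto_exp_at_top_zero:
  fixes c :: real
  assumes "c > 0"
  shows "((\<lambda>u. exp (- (c * u))) \<longlongrightarrow> 0) at_top"
proof -
  have "filterlim (\<lambda>u. c * u) at_top at_top"
    using assms by (intro filterlim_tendsto_pos_mult_at_top[OF tendsto_const _ filterlim_ident])
  then have "filterlim (\<lambda>u. - (c * u)) at_bot at_top" by (simp add: filterlim_uminus_at_bot)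
  then show ?thesis by (rule filterlim_compose[OF exp_at_bot])
qed

text \<open>
  \<open>rise_curve\<close> is \<open>s l\<close> while it climbs from \<open>0\<close> at time \<open>T = t (l + 1)\<close> to the threshold \<open>\<rho> / l\<close>,
  with \<open>a = \<alpha> (l + 1)\<close>; \<open>upper_curve\<close> is \<open>s l\<close> afterwards, with \<open>a = \<alpha> l\<close>.
\<close>

definition upper_curve :: "nat \<Rightarrow> real \<Rightarrow> real \<Rightarrow> nat \<Rightarrow> (nat \<Rightarrow> real) \<Rightarrow> real \<Rightarrow> real" where
  "upper_curve d \<mu> \<beta> l a u = \<beta> * (1 - (\<Sum>i=l+1..d. a i * exp (- real i * \<mu> * u)))"

definition rise_coeff :: "nat \<Rightarrow> real \<Rightarrow> real \<Rightarrow> real \<Rightarrow> nat \<Rightarrow> (nat \<Rightarrow> real) \<Rightarrow> real \<Rightarrow> nat \<Rightarrow> real" where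
  "rise_coeff d \<mu> \<beta> \<rho> l a T j =
     (if j = 1
      then - ((real (l + 1) * \<beta> - \<rho>) * exp (\<mu> * T)
              + (\<Sum>i=l+2..d. \<beta> * real (l + 1) / (real i - 1) * a i * exp (- \<mu> * (real i - 1) * T)))
      else \<beta> * real (l + 1) / (real j - 1) * a j)"

definition rise_curve :: "nat \<Rightarrow> real \<Rightarrow> real \<Rightarrow> real \<Rightarrow> nat \<Rightarrow> (nat \<Rightarrow> real) \<Rightarrow> real \<Rightarrow> real \<Rightarrow> real" where
  "rise_curve d \<mu> \<beta> \<rho> l a T u = real (l + 1) * \<beta> - \<rho> + rise_coeff d \<mu> \<beta> \<rho> l a T 1 * exp (- \<mu> * u)
     + (\<Sum>i=l+2..d. rise_coeff d \<mu> \<beta> \<rho> l a T i * exp (- \<mu> * real i * u))"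

text \<open>Comparing coefficients of \<open>exp (- i * \<mu> * u)\<close> gives
  \<open>(l + 1 - i) * a' i = (l + 1) * a i\<close>, the stated recursion. For
  \<open>i = l + 1\<close> the equation is void: that term is the homogeneous solution, and its
  coefficient remains free.\<close>

lemma upper_curve_derivative:
  assumes l: "l + 1 \<le> d"
    and a': "\<And>j. j \<in> {l+2..d} \<Longrightarrow> a' j = real (l + 1) / (real (l + 1) - real j) * a j"
  shows "(upper_curve d \<mu> \<beta> l a' has_real_derivative
           real (l + 1) * \<mu> * (upper_curve d \<mu> \<beta> (l + 1) a u - upper_curve d \<mu> \<beta> l a' u)) (at u)"
proof -
  define e where "e i = exp (- real i * \<mu> * u)" for i
  have "(upper_curve d \<mu> \<beta> l a' has_real_derivative \<beta> * (\<Sum>i=l+1..d. real i * \<mu> * (a' i * e i))) (at u)"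
    unfolding upper_curve_def e_def
    by (auto intro!: derivative_eq_intros simp: sum_negf mult_ac)
  moreover have "\<beta> * (\<Sum>i=l+1..d. real i * \<mu> * (a' i * e i))
      = real (l + 1) * \<mu> * (upper_curve d \<mu> \<beta> (l + 1) a u - upper_curve d \<mu> \<beta> l a' u)"
  proof -
    have split: "(\<Sum>i=l+1..d. h i) = h (l + 1) + (\<Sum>i=l+2..d. h i)" for h :: "nat \<Rightarrow> real"
      using l by (simp add: sum.atLeast_Suc_atMost)
    have "(\<Sum>i=l+2..d. real i * \<mu> * (a' i * e i)) = (\<Sum>i=l+2..d. real (l + 1) * \<mu> * (a' i * e i - a i * e i))"
    proof (rule sum.cong)
      fix i assume i: "i \<in> {l+2..d}"
      then have "real (l + 1) - real i \<noteq> 0" by auto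
      then have "real i * a' i = real (l + 1) * (a' i - a i)"
        unfolding a'[OF i] by (simp add: field_simps)
      then have "(real i * a' i) * (\<mu> * e i) = (real (l + 1) * (a' i - a i)) * (\<mu> * e i)" by simp
      then show "real i * \<mu> * (a' i * e i) = real (l + 1) * \<mu> * (a' i * e i - a i * e i)"
        by (simp add: algebra_simps)
    qed simp
    also have "\<dots> = real (l + 1) * \<mu> * ((\<Sum>i=l+2..d. a' i * e i) - (\<Sum>i=l+2..d. a i * e i))"
      by (simp add: sum_distrib_left[symmetric] sum_subtractf)
    finally have sum: "(\<Sum>i=l+2..d. real i * \<mu> * (a' i * e i))
      = real (l + 1) * \<mu> * ((\<Sum>i=l+2..d. a' i * e i) - (\<Sum>i=l+2..d. a i * e i))" .
    have up: "upper_curve d \<mu> \<beta> (l + 1) a u = \<beta> * (1 - (\<Sum>i=l+2..d. a i * e i))"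
      unfolding upper_curve_def e_def by simp
    have lo: "upper_curve d \<mu> \<beta> l a' u = \<beta> * (1 - (\<Sum>i=l+1..d. a' i * e i))"
      unfolding upper_curve_def e_def ..
    show ?thesis unfolding up lo split sum by algebra
  qed
  ultimately show ?thesis by simp
qed

text \<open>Here comparison of coefficients gives \<open>(i - 1)\<close> times the
  \<open>i\<close>-th coefficient equal to \<open>\<beta> * (l + 1) * a i\<close>, the second branch
  of \<open>rise_coeff\<close>; the homogeneous solution is now
  \<open>exp (- \<mu> * u)\<close>.\<close>

lemma rise_curve_derivative:
  "(rise_curve d \<mu> \<beta> (lam / \<mu>) l a T has_real_derivative
      \<mu> * (real (l + 1) * upper_curve d \<mu> \<beta> (l + 1) a u - lam / \<mu> - rise_curve d \<mu> \<beta> (lam / \<mu>) l a T u)) (at u)"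
proof -
  define e where "e i = exp (- \<mu> * real i * u)" for i
  define \<rho> where "\<rho> = lam / \<mu>"
  define x where "x = rise_coeff d \<mu> \<beta> \<rho> l a T"
  have "(rise_curve d \<mu> \<beta> \<rho> l a T has_real_derivative
      - \<mu> * (x 1 * exp (- \<mu> * u)) - (\<Sum>i=l+2..d. \<mu> * real i * (x i * e i))) (at u)"
    unfolding rise_curve_def e_def x_def[symmetric]
    by (auto intro!: derivative_eq_intros simp: sum_negf mult_ac)
  moreover have "- \<mu> * (x 1 * exp (- \<mu> * u)) - (\<Sum>i=l+2..d. \<mu> * real i * (x i * e i))
      = \<mu> * (real (l + 1) * upper_curve d \<mu> \<beta> (l + 1) a u - \<rho> - rise_curve d \<mu> \<beta> \<rho> l a T u)"
  proof -
    have "(\<Sum>i=l+2..d. \<mu> * real i * (x i * e i)) = (\<Sum>i=l+2..d. \<mu> * (x i * e i) + \<mu> * real (l + 1) * \<beta> * (a i * e i))"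
    proof (rule sum.cong)
      fix i assume i: "i \<in> {l+2..d}"
      then have "real i - 1 \<noteq> 0" by auto
      then have "real i * x i = x i + real (l + 1) * \<beta> * a i"
        using i unfolding x_def rise_coeff_def by (simp add: field_simps)
      then have "(real i * x i) * (\<mu> * e i) = (x i + real (l + 1) * \<beta> * a i) * (\<mu> * e i)" by simp
      then show "\<mu> * real i * (x i * e i) = \<mu> * (x i * e i) + \<mu> * real (l + 1) * \<beta> * (a i * e i)"
        by (simp add: algebra_simps)
    qed simp
    also have "\<dots> = \<mu> * (\<Sum>i=l+2..d. x i * e i) + \<mu> * real (l + 1) * \<beta> * (\<Sum>i=l+2..d. a i * e i)"
      by (simp add: sum_distrib_left[symmetric] sum.distrib)
    finally have sum: "(\<Sum>i=l+2..d. \<mu> * real i * (x i * e i))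
      = \<mu> * (\<Sum>i=l+2..d. x i * e i) + \<mu> * real (l + 1) * \<beta> * (\<Sum>i=l+2..d. a i * e i)" .
    have up: "upper_curve d \<mu> \<beta> (l + 1) a u = \<beta> * (1 - (\<Sum>i=l+2..d. a i * e i))"
      unfolding upper_curve_def e_def by (simp add: mult.commute)
    have ri: "rise_curve d \<mu> \<beta> \<rho> l a T u = real (l + 1) * \<beta> - \<rho> + x 1 * exp (- \<mu> * u) + (\<Sum>i=l+2..d. x i * e i)"
      unfolding rise_curve_def e_def x_def ..
    show ?thesis unfolding up ri sum by algebra
  qed
  ultimately show ?thesis by (simp add: \<rho>_def)
qed

text \<open>This is the condition that determines the free coefficient of index \<open>1\<close>:
  multiplied by \<open>exp (- \<mu> * T)\<close> it cancels all other terms.\<close>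

lemma rise_curve_start: "rise_curve d \<mu> \<beta> \<rho> l a T T = 0"
proof -
  have "rise_coeff d \<mu> \<beta> \<rho> l a T 1 * exp (- \<mu> * T) = - (real (l + 1) * \<beta> - \<rho>) -
      (\<Sum>i=l+2..d. rise_coeff d \<mu> \<beta> \<rho> l a T i * exp (- \<mu> * real i * T))"
  proof -
    define K where "K = real (l + 1) * \<beta> - \<rho>"
    define S where "S = (\<Sum>i=l+2..d. \<beta> * real (l + 1) / (real i - 1) * a i * exp (- \<mu> * (real i - 1) * T))"
    have "S * exp (- \<mu> * T) = (\<Sum>i=l+2..d. rise_coeff d \<mu> \<beta> \<rho> l a T i * exp (- \<mu> * real i * T))"
      unfolding S_def sum_distrib_right
    proof (rule sum.cong)
      fix i assume "i \<in> {l+2..d}"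
      then have i: "i \<noteq> 1" by auto
      have "exp (- \<mu> * (real i - 1) * T) * exp (- \<mu> * T) = exp (- \<mu> * real i * T)"
        by (simp add: exp_add[symmetric] algebra_simps)
      then show "\<beta> * real (l + 1) / (real i - 1) * a i * exp (- \<mu> * (real i - 1) * T) * exp (- \<mu> * T)
          = rise_coeff d \<mu> \<beta> \<rho> l a T i * exp (- \<mu> * real i * T)"
        using i unfolding rise_coeff_def by (simp only: mult.assoc if_False)
    qed simp
    moreover have "exp (\<mu> * T) * exp (- \<mu> * T) = 1" by (simp add: exp_minus)
    moreover have "rise_coeff d \<mu> \<beta> \<rho> l a T 1 = - (K * exp (\<mu> * T) + S)"
      unfolding rise_coeff_def K_def S_def by simp
    moreover have "r * e' = - K - W" if "S * e' = W" "e * e' = 1" "r = - (K * e + S)" for r e e' W :: real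
    proof -
      have "r * e' = - K * (e * e') - S * e'" unfolding that(3) by (simp add: algebra_simps)
      then show ?thesis using that by simp
    qed
    ultimately show ?thesis unfolding K_def[symmetric] by blast
  qed
  then show ?thesis unfolding rise_curve_def by simp
qed

lemma rise_curve_limit:
  assumes "\<mu> > 0"
  shows "(rise_curve d \<mu> \<beta> \<rho> l a T \<longlongrightarrow> real (l + 1) * \<beta> - \<rho>) at_top"
proof -
  have "(rise_curve d \<mu> \<beta> \<rho> l a T \<longlongrightarrow> real (l + 1) * \<beta> - \<rho> + rise_coeff d \<mu> \<beta> \<rho> l a T 1 * 0
      + (\<Sum>i=l+2..d. rise_coeff d \<mu> \<beta> \<rho> l a T i * 0)) at_top"
    unfolding rise_curve_def
  proof (intro tendsto_intros)
    show "((\<lambda>u. exp (- \<mu> * u)) \<longlongrightarrow> 0) at_top" using tendsto_exp_at_top_zero[OF assms] by simp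
    fix i assume "i \<in> {l+2..d}"
    then show "((\<lambda>u. exp (- \<mu> * real i * u)) \<longlongrightarrow> 0) at_top"
      using tendsto_exp_at_top_zero[of "\<mu> * real i"] assms by simp
  qed
  then show ?thesis by simp
qed

section \<open>The three phases of one component\<close>

definition drift :: "real \<Rightarrow> real \<Rightarrow> nat \<Rightarrow> real \<Rightarrow> real \<Rightarrow> real" where
  "drift \<mu> lam l y z = real (l + 1) * \<mu> * (y - z) + max 0 (lam - real (l + 1) * \<mu> * y)
     - max 0 (lam - real l * \<mu> * z)"

lemma threshold_iff:
  fixes \<mu> k :: real
  assumes "\<mu> > 0" "k > 0"
  shows "y \<le> lam / \<mu> / k \<longleftrightarrow> k * \<mu> * y \<le> lam" "lam / \<mu> / k \<le> y \<longleftrightarrow> lam \<le> k * \<mu> * y"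
  using assms by (simp_all add: field_simps)

text \<open>At level \<open>0\<close> the outgoing push is the full \<open>lam\<close>, and the
  incoming push tops the inflow \<open>(l + 1) * \<mu> * y\<close> up to exactly
  \<open>lam\<close>.\<close>

lemma drift_waiting:
  assumes "\<mu> > 0" "lam > 0" "y \<le> lam / \<mu> / real (l + 1)"
  shows "drift \<mu> lam l y 0 = 0"
proof -
  have "real (l + 1) * \<mu> * y \<le> lam"
    using threshold_iff(1)[of \<mu> "real (l + 1)" y lam] assms by linarith
  then show ?thesis using assms by (simp add: drift_def max_def)
qed

text \<open>Only the outgoing push \<open>lam - l * \<mu> * z\<close> is active. It cancels
  \<open>l\<close> of the \<open>l + 1\<close> units of the relaxation rate in \<open>z\<close>,
  which is why the rising phase carries \<open>exp (- \<mu> * u)\<close>.\<close>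

lemma drift_rising:
  assumes "\<mu> > 0" "lam > 0" "lam / \<mu> / real (l + 1) \<le> y" "l \<ge> 1" "z \<le> lam / \<mu> / real l"
  shows "drift \<mu> lam l y z = \<mu> * (real (l + 1) * y - lam / \<mu> - z)"
proof -
  have "real (l + 1) * \<mu> * y \<ge> lam" "real l * \<mu> * z \<le> lam"
    using threshold_iff(2)[of \<mu> "real (l + 1)" lam y] threshold_iff(1)[of \<mu> "real l" z lam] assms by linarith+
  then show ?thesis using assms by (simp add: drift_def field_simps)
qed

lemma drift_free:
  assumes "\<mu> > 0" "lam > 0" "lam / \<mu> / real (l + 1) \<le> y" "l \<ge> 1" "lam / \<mu> / real l \<le> z"
  shows "drift \<mu> lam l y z = real (l + 1) * \<mu> * (y - z)"
proof -
  have "real (l + 1) * \<mu> * y \<ge> lam" "real l * \<mu> * z \<ge> lam"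
    using threshold_iff(2)[of \<mu> "real (l + 1)" lam y] threshold_iff(2)[of \<mu> "real l" lam z] assms by linarith+
  then show ?thesis by (simp add: drift_def)
qed

text \<open>
  Invariant of the recursion on \<open>l\<close>: \<open>g\<close> is a candidate for \<open>s l\<close> that passes \<open>\<rho> / l\<close> at time \<open>T\<close>.
  For \<open>l = d\<close> the constant \<open>\<beta>\<close> is already above the threshold at \<open>T = 0\<close>, so only
  \<open>\<rho> / l \<le> g T\<close> is required.
\<close>

definition level :: "nat \<Rightarrow> real \<Rightarrow> real \<Rightarrow> real \<Rightarrow> nat \<Rightarrow> real \<Rightarrow> (nat \<Rightarrow> real) \<Rightarrow> (real \<Rightarrow> real) \<Rightarrow> bool" where
  "level d \<mu> \<beta> \<rho> l T a g \<longleftrightarrow>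
     0 \<le> T \<and> continuous_on {0..} g \<and> (\<forall>u\<ge>0. 0 \<le> g u) \<and> (\<forall>u\<in>{0..<T}. g u \<le> \<rho> / real l) \<and>
     (\<forall>u\<ge>T. \<rho> / real l \<le> g u \<and> g u = upper_curve d \<mu> \<beta> l a u \<and> g u \<le> \<beta>) \<and>
     (\<forall>u>T. \<rho> / real l < g u) \<and> mono_on {T..} g"

text \<open>The integral form tolerates the corners between phases. The second clause says that the
  push is off whenever \<open>g > 0\<close>, which yields complementarity.\<close>

definition follows :: "real \<Rightarrow> real \<Rightarrow> nat \<Rightarrow> (real \<Rightarrow> real) \<Rightarrow> (real \<Rightarrow> real) \<Rightarrow> bool" where
  "follows \<mu> lam l f g \<longleftrightarrow>
     (\<forall>t\<ge>0. ((\<lambda>u. drift \<mu> lam l (f u) (g u)) has_integral g t) {0..t}) \<and>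
     (\<forall>u\<ge>0. g u > 0 \<longrightarrow> lam \<le> real (l + 1) * \<mu> * f u)"

lemma has_integral_from_zero:
  fixes g :: "real \<Rightarrow> real"
  assumes "continuous_on {0..} g" "g 0 = 0" "finite E" "t \<ge> 0"
    and "\<And>u. u > 0 \<Longrightarrow> u \<notin> E \<Longrightarrow> (g has_real_derivative D u) (at u)"
  shows "(D has_integral g t) {0..t}"
proof -
  have "(D has_integral (g t - g 0)) {0..t}"
  proof (rule fundamental_theorem_of_calculus_interior_strong[OF \<open>finite E\<close> \<open>t \<ge> 0\<close>])
    show "continuous_on {0..t} g" using assms(1) by (rule continuous_on_subset) auto
  qed (use assms(5) in \<open>auto simp: has_real_derivative_iff_has_vector_derivative[symmetric]\<close>)
  then show ?thesis using assms(2) by simp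
qed

text \<open>The curve relaxes towards the moving target \<open>(l + 1) * f - lam / \<mu>\<close>. As
  \<open>f\<close> is monotone after \<open>T\<close>, the target up to time \<open>t\<close> is at
  most its value at \<open>t\<close>, and this value is positive because \<open>f\<close> is
  strictly above its threshold after \<open>T\<close>.\<close>

lemma rise_curve_below:
  assumes \<mu>: "\<mu> > 0" and lev: "level d \<mu> \<beta> (lam / \<mu>) (l + 1) T a f" and t: "t > T"
  shows "rise_curve d \<mu> \<beta> (lam / \<mu>) l a T t < real (l + 1) * f t - lam / \<mu>"
proof (rule relaxation_stays_below[where c=\<mu> and T=T and t=t and M="real (l + 1) * f t - lam / \<mu>"
      and y="rise_curve d \<mu> \<beta> (lam / \<mu>) l a T" and f="\<lambda>u. real (l + 1) * upper_curve d \<mu> \<beta> (l + 1) a u - lam / \<mu>"])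
  show "rise_curve d \<mu> \<beta> (lam / \<mu>) l a T T < real (l + 1) * f t - lam / \<mu>"
  proof -
    have "lam / \<mu> / real (l + 1) < f t" using lev t by (auto simp: level_def)
    then have "lam / \<mu> < f t * real (l + 1)" by (subst (asm) pos_divide_less_eq) auto
    then show ?thesis unfolding rise_curve_start by (simp add: mult.commute)
  qed
  fix u assume u: "u \<in> {T..t}"
  have "f u = upper_curve d \<mu> \<beta> (l + 1) a u" "f u \<le> f t"
    using lev u t by (auto simp: level_def mono_on_def)
  then show "real (l + 1) * upper_curve d \<mu> \<beta> (l + 1) a u - lam / \<mu> \<le> real (l + 1) * f t - lam / \<mu>"
    by (simp add: mult_left_mono)
  show "(rise_curve d \<mu> \<beta> (lam / \<mu>) l a T has_real_derivative
      \<mu> * (real (l + 1) * upper_curve d \<mu> \<beta> (l + 1) a u - lam / \<mu> - rise_curve d \<mu> \<beta> (lam / \<mu>) l a T u)) (at u)"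
    by (rule rise_curve_derivative)
qed (use \<mu> t in auto)

lemma rise_curve_increasing:
  assumes \<mu>: "\<mu> > 0" and lev: "level d \<mu> \<beta> (lam / \<mu>) (l + 1) T a f" and uv: "T \<le> u" "u < v"
  shows "rise_curve d \<mu> \<beta> (lam / \<mu>) l a T u < rise_curve d \<mu> \<beta> (lam / \<mu>) l a T v"
\<comment> \<open>The derivative is \<mu> times the distance to the target. It may vanish at
  \<open>T\<close> itself, so only interior points are used.\<close>
proof (rule DERIV_pos_imp_increasing_open[OF uv(2)])
  fix x assume x: "u < x" "x < v"
  have "f x = upper_curve d \<mu> \<beta> (l + 1) a x" using lev x uv by (auto simp: level_def)
  then have "0 < \<mu> * (real (l + 1) * upper_curve d \<mu> \<beta> (l + 1) a x - lam / \<mu> - rise_curve d \<mu> \<beta> (lam / \<mu>) l a T x)"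
    using rise_curve_below[OF \<mu> lev, of x] x uv \<mu> by (intro mult_pos_pos) auto
  then show "\<exists>y. (rise_curve d \<mu> \<beta> (lam / \<mu>) l a T has_real_derivative y) (at x) \<and> 0 < y"
    using rise_curve_derivative by blast
next
  show "continuous_on {u..v} (rise_curve d \<mu> \<beta> (lam / \<mu>) l a T)"
    unfolding rise_curve_def by (intro continuous_intros)
qed

section \<open>Construction of one component from the next\<close>

text \<open>If \<open>l * \<beta> \<le> lam / \<mu>\<close>, multiplying by \<open>l + 1\<close>
  shows that the largest possible target \<open>(l + 1) * \<beta> - lam / \<mu>\<close> is at most
  \<open>lam / \<mu> / l\<close>. The threshold is never exceeded and the rising phase lasts
  forever.\<close>

lemma last_level:
  assumes \<mu>: "\<mu> > 0" and lam: "lam > 0" and lev: "level d \<mu> \<beta> (lam / \<mu>) (l + 1) T a f"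
    and l: "l \<ge> 1" and stop: "real l * \<beta> \<le> lam / \<mu>"
  obtains g where "continuous_on {0..} g" "\<And>u. u \<ge> 0 \<Longrightarrow> 0 \<le> g u"
    "\<And>u. u \<in> {0..T} \<Longrightarrow> g u = 0" "\<And>u. u \<ge> T \<Longrightarrow> g u = rise_curve d \<mu> \<beta> (lam / \<mu>) l a T u"
    "\<And>u. u \<ge> 0 \<Longrightarrow> g u \<le> lam / \<mu> / real l" "follows \<mu> lam l f g"
proof
  define A where "A = rise_curve d \<mu> \<beta> (lam / \<mu>) l a T"
  define g where "g u = A (max T u)" for u
  have T: "T \<ge> 0" using lev by (simp add: level_def)
  have A0: "A T = 0" unfolding A_def by (rule rise_curve_start)
  have Ainc: "A u < A v" if "T \<le> u" "u < v" for u v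
    unfolding A_def by (rule rise_curve_increasing[OF \<mu> lev that])
  have Ale: "A u \<le> lam / \<mu> / real l" if u: "u \<ge> T" for u
  proof (cases "u = T")
    case True
    then show ?thesis using A0 \<mu> lam by simp
  next
    case False
    then have "A u < real (l + 1) * f u - lam / \<mu>"
      unfolding A_def using u by (intro rise_curve_below[OF \<mu> lev]) auto
    also have "\<dots> \<le> real (l + 1) * \<beta> - lam / \<mu>"
      using lev u by (auto simp: level_def intro!: mult_left_mono)
    also have "\<dots> \<le> lam / \<mu> / real l"
    proof -
      have "real (l + 1) * (real l * \<beta>) \<le> real (l + 1) * (lam / \<mu>)"
        using stop by (intro mult_left_mono) auto
      then have "real l * (real (l + 1) * \<beta> - lam / \<mu>) \<le> lam / \<mu>" by (simp add: algebra_simps)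
      moreover have "x \<le> c / real l" if "real l * x \<le> c" for c x
        using that l by (simp add: field_simps)
      ultimately show ?thesis by blast
    qed
    finally show ?thesis by simp
  qed
  show "continuous_on {0..} g"
  proof -
    have "continuous_on UNIV A" unfolding A_def rise_curve_def by (intro continuous_intros)
    then show ?thesis unfolding g_def by (rule continuous_on_compose2) (auto intro!: continuous_intros)
  qed
  note gcont = this
  show before: "g u = 0" if "u \<in> {0..T}" for u using that A0 by (cases "u = T") (auto simp: g_def max_def)
  show after: "g u = rise_curve d \<mu> \<beta> (lam / \<mu>) l a T u" if "u \<ge> T" for u
    using that by (simp add: g_def A_def max_def)
  show gnonneg: "0 \<le> g u" for u
    unfolding g_def using Ainc[of T "max T u"] A0 by (cases "u > T") (auto simp: max_def)
  show gle: "g u \<le> lam / \<mu> / real l" for u unfolding g_def by (intro Ale) simp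
  show "follows \<mu> lam l f g"
    unfolding follows_def
  proof (intro conjI allI impI)
    fix t :: real assume "t \<ge> 0"
    then show "((\<lambda>u. drift \<mu> lam l (f u) (g u)) has_integral g t) {0..t}"
    proof (intro has_integral_from_zero[OF gcont _ finite.insertI[OF finite.emptyI, of T]])
      show "g 0 = 0" using before[of 0] T by simp
      fix u :: real assume u: "u > 0" "u \<notin> {T}"
      show "(g has_real_derivative drift \<mu> lam l (f u) (g u)) (at u)"
      proof (cases "u < T")
        case True
        have "f u \<le> lam / \<mu> / real (l + 1)" using lev u True by (auto simp: level_def)
        then have "drift \<mu> lam l (f u) (g u) = 0"
          using drift_waiting[OF \<mu> lam] before[of u] u True by simp
        moreover have "(g has_real_derivative 0) (at u)"
          by (rule has_field_derivative_transform_within_open[OF DERIV_const[of 0], of "{0<..<T}"])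
             (use u True before in auto)
        ultimately show ?thesis by simp
      next
        case False
        then have uT: "u > T" using u by auto
        have fu: "lam / \<mu> / real (l + 1) \<le> f u" "f u = upper_curve d \<mu> \<beta> (l + 1) a u"
          using lev uT by (auto simp: level_def)
        have "drift \<mu> lam l (f u) (g u) = \<mu> * (real (l + 1) * f u - lam / \<mu> - g u)"
          by (rule drift_rising[OF \<mu> lam fu(1) l gle])
        moreover have "(g has_real_derivative \<mu> * (real (l + 1) * f u - lam / \<mu> - A u)) (at u)"
          unfolding A_def fu(2)
          by (rule has_field_derivative_transform_within_open[OF rise_curve_derivative, of "{T<..}"])
             (use uT after in auto)
        ultimately show ?thesis using after[of u] uT by (simp add: A_def)
      qed
    qed
  next
    fix u :: real assume u: "u \<ge> 0" "g u > 0"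
    then have "u \<ge> T" using before[of u] by (cases "u \<le> T") auto
    then have "lam / \<mu> / real (l + 1) \<le> f u" using lev by (auto simp: level_def)
    then show "lam \<le> real (l + 1) * \<mu> * f u"
      using threshold_iff(2)[of \<mu> "real (l + 1)" lam "f u"] \<mu> by simp
  qed
qed

text \<open>The crossing time comes from the intermediate value theorem. After it the equation fixes
  all coefficients except that of the homogeneous solution; continuity at \<open>T'\<close> fixes
  this one, which is the origin of the formula for \<open>a' (l + 1)\<close>.\<close>

lemma next_level:
  assumes \<mu>: "\<mu> > 0" and lam: "lam > 0" and \<beta>: "\<beta> > 0"
    and lev: "level d \<mu> \<beta> (lam / \<mu>) (l + 1) T a f"
    and l: "l \<ge> 1" "l + 1 \<le> d" and less: "lam / \<mu> < real l * \<beta>"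
  obtains T' a' g where "level d \<mu> \<beta> (lam / \<mu>) l T' a' g" "T < T'"
    "\<And>u. u \<in> {0..T} \<Longrightarrow> g u = 0"
    "\<And>u. u \<in> {T..T'} \<Longrightarrow> g u = rise_curve d \<mu> \<beta> (lam / \<mu>) l a T u"
    "\<And>u. u \<ge> 0 \<Longrightarrow> g u = lam / \<mu> / real l \<longleftrightarrow> u = T'"
    "\<And>j. j \<in> {l+2..d} \<Longrightarrow> a' j = real (l + 1) / (real (l + 1) - real j) * a j"
    "a' (l + 1) = exp (real (l + 1) * \<mu> * T') *
        (1 - lam / \<mu> / (real l * \<beta>) - (\<Sum>k=l+2..d. a' k * exp (- real k * \<mu> * T')))"
    "follows \<mu> lam l f g"
proof -
  define A where "A = rise_curve d \<mu> \<beta> (lam / \<mu>) l a T"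
  have T: "T \<ge> 0" using lev by (simp add: level_def)
  have A0: "A T = 0" unfolding A_def by (rule rise_curve_start)
  have Ainc: "A u < A v" if "T \<le> u" "u < v" for u v
    unfolding A_def by (rule rise_curve_increasing[OF \<mu> lev that])
  have Acont: "continuous_on X A" for X
    unfolding A_def rise_curve_def by (intro continuous_intros)
  have thr: "lam / \<mu> / real l > 0" using \<mu> lam l by simp
  obtain T' where T': "T < T'" "A T' = lam / \<mu> / real l"
  proof -
    have "lam / \<mu> / real l < real (l + 1) * \<beta> - lam / \<mu>"
    proof -
      have "real (l + 1) * (lam / \<mu>) < real (l + 1) * (real l * \<beta>)"
        using less by (intro mult_strict_left_mono) auto
      then have "lam / \<mu> < real l * (real (l + 1) * \<beta> - lam / \<mu>)" by (simp add: algebra_simps)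
      moreover have "c / real l < x" if "c < real l * x" for c x
        using that l by (simp add: field_simps)
      ultimately show ?thesis by blast
    qed
    then have "\<forall>\<^sub>F u in at_top. lam / \<mu> / real l < A u"
      unfolding A_def by (rule order_tendstoD(1)[OF rise_curve_limit[OF \<mu>]])
    then obtain N where "\<And>u. u \<ge> N \<Longrightarrow> lam / \<mu> / real l < A u" by (auto simp: eventually_at_top_linorder)
    then have "lam / \<mu> / real l \<le> A (max N T)" by (simp add: less_imp_le)
    then obtain x where "T \<le> x" "A x = lam / \<mu> / real l"
      using IVT'[of A T "lam / \<mu> / real l" "max N T"] A0 thr Acont by auto
    then show ?thesis using that[of x] A0 thr by (cases "x = T") auto
  qed
  define b where "b j = real (l + 1) / (real (l + 1) - real j) * a j" for j
  define a' where "a' j = (if j = l + 1 then exp (real (l + 1) * \<mu> * T') *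
      (1 - lam / \<mu> / (real l * \<beta>) - (\<Sum>k=l+2..d. b k * exp (- real k * \<mu> * T'))) else b j)" for j
  have a'b: "a' j = b j" if "j \<in> {l+2..d}" for j using that by (auto simp: a'_def)
  have sumb: "(\<Sum>k=l+2..d. b k * exp (- real k * \<mu> * t)) = (\<Sum>k=l+2..d. a' k * exp (- real k * \<mu> * t))" for t
    by (rule sum.cong) (auto simp: a'b)
  have a'l: "a' (l + 1) = exp (real (l + 1) * \<mu> * T') *
      (1 - lam / \<mu> / (real l * \<beta>) - (\<Sum>k=l+2..d. a' k * exp (- real k * \<mu> * T')))"
    unfolding sumb[symmetric] by (simp add: a'_def)
  define U where "U = upper_curve d \<mu> \<beta> l a'"
  have Uderiv: "(U has_real_derivative real (l + 1) * \<mu> * (upper_curve d \<mu> \<beta> (l + 1) a u - U u)) (at u)" for u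
    unfolding U_def by (rule upper_curve_derivative) (use l a'b in \<open>auto simp: b_def\<close>)
  have UT': "U T' = lam / \<mu> / real l"
  proof -
    have split: "(\<Sum>i=l+1..d. h i) = h (l + 1) + (\<Sum>i=l+2..d. h i)" for h :: "nat \<Rightarrow> real"
      using l by (simp add: sum.atLeast_Suc_atMost)
    have "(\<Sum>i=l+1..d. a' i * exp (- real i * \<mu> * T'))
        = a' (l + 1) * exp (- real (l + 1) * \<mu> * T') + (\<Sum>i=l+2..d. a' i * exp (- real i * \<mu> * T'))"
      by (rule split)
    also have "a' (l + 1) * exp (- real (l + 1) * \<mu> * T')
        = 1 - lam / \<mu> / (real l * \<beta>) - (\<Sum>k=l+2..d. a' k * exp (- real k * \<mu> * T'))"
    proof -
      have "exp (real (l + 1) * \<mu> * T') * exp (- real (l + 1) * \<mu> * T') = 1"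
        by (simp add: exp_add[symmetric] algebra_simps)
      then show ?thesis using a'l by algebra
    qed
    finally have "U T' = \<beta> * (lam / \<mu> / (real l * \<beta>))"
      unfolding U_def upper_curve_def by simp
    then show ?thesis using \<beta> by simp
  qed
  have f: "lam / \<mu> / real (l + 1) \<le> f u" "f u = upper_curve d \<mu> \<beta> (l + 1) a u" "f u \<le> \<beta>" if "u \<ge> T" for u
    using lev that by (auto simp: level_def)
  have fmono: "f u \<le> f v" if "T \<le> u" "u \<le> v" for u v
    using lev that by (auto simp: level_def mono_on_def)
  \<comment> \<open>At \<open>T'\<close>, \<open>rise_curve_below\<close> gives
    \<open>lam / \<mu> / l + lam / \<mu> < (l + 1) * f T'\<close>. The left side equals
    \<open>(l + 1) * (lam / \<mu> / l)\<close>, so \<open>f T'\<close> exceeds the value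
    \<open>lam / \<mu> / l\<close> of \<open>U\<close> there.\<close>
  have Uf: "U t < f t" if t: "t \<ge> T'" for t
  proof (rule relaxation_stays_below[where c="real (l + 1) * \<mu>" and y=U and t=t and M="f t" and f="upper_curve d \<mu> \<beta> (l + 1) a", OF _ t Uderiv])
    have scale: "real (l + 1) * (c / real l) = c + c / real l" for c
      using l by (simp add: field_simps)
    have "lam / \<mu> / real l < real (l + 1) * f T' - lam / \<mu>"
      using rise_curve_below[OF \<mu> lev T'(1)] T'(2) by (simp add: A_def)
    then have "real (l + 1) * (lam / \<mu> / real l) < real (l + 1) * f T'"
      using scale[of "lam / \<mu>"] by linarith
    then have "lam / \<mu> / real l < f T'" by (simp only: mult_less_cancel_left_pos of_nat_0_less_iff add_gr_0 zero_less_one simp_thms)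
    also have "\<dots> \<le> f t" using T' t by (intro fmono) auto
    finally show "U T' < f t" by (simp add: UT')
    fix u assume "u \<in> {T'..t}"
    then show "upper_curve d \<mu> \<beta> (l + 1) a u \<le> f t" using f(2)[of u] fmono[of u t] T' by auto
  qed (use \<mu> in auto)
  have Ucont: "continuous_on X U" for X
    unfolding U_def upper_curve_def by (intro continuous_intros)
  have Uinc: "U u < U v" if uv: "T' \<le> u" "u < v" for u v
  proof (rule DERIV_pos_imp_increasing_open[OF uv(2) _ Ucont])
    fix x assume x: "u < x" "x < v"
    have "0 < real (l + 1) * \<mu> * (upper_curve d \<mu> \<beta> (l + 1) a x - U x)"
      using Uf[of x] f(2)[of x] x uv T' \<mu> by (intro mult_pos_pos) auto
    then show "\<exists>y. (U has_real_derivative y) (at x) \<and> 0 < y" using Uderiv by blast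
  qed
  \<comment> \<open>Clamping the times makes continuity immediate: the second summand is
    \<open>0\<close> up to \<open>T'\<close>, and from \<open>T'\<close> on the constant
    \<open>A T' = U T'\<close> cancels.\<close>
  define g where "g u = A (max T (min u T')) + (U (max u T') - U T')" for u
  have g1: "g u = 0" if "u \<le> T" for u using that T' A0 by (cases "u = T") (auto simp: g_def max_def min_def)
  have g2: "g u = A u" if "u \<in> {T..T'}" for u using that by (simp add: g_def max_def min_def)
  have g3: "g u = U u" if "u \<ge> T'" for u using that T' UT' by (simp add: g_def max_def min_def)
  have below: "g u < lam / \<mu> / real l" if "u < T'" for u
  proof (cases "u \<le> T")
    case True
    then show ?thesis using g1 thr by simp
  next
    case False
    then show ?thesis using g2[of u] Ainc[of u T'] that T' by simp
  qed
  have above: "lam / \<mu> / real l < g u" if "u > T'" for u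
    using Uinc[of T' u] g3[of u] that UT' by simp
  have gT': "g T' = lam / \<mu> / real l" using g3[of T'] UT' by simp
  have gcont: "continuous_on {0..} g"
    unfolding g_def
    by (intro continuous_intros continuous_on_compose2[OF Acont[of UNIV]] continuous_on_compose2[OF Ucont[of UNIV]]) auto
  have gnonneg: "0 \<le> g u" for u
  proof -
    consider "u \<le> T" | "T < u" "u \<le> T'" | "T' < u" by linarith
    then show ?thesis
    proof cases
      case 2
      then show ?thesis using g2[of u] Ainc[of T u] A0 by simp
    next
      case 3
      then show ?thesis using above[of u] thr by simp
    qed (use g1 in simp)
  qed
  have lev': "level d \<mu> \<beta> (lam / \<mu>) l T' a' g"
    unfolding level_def
  proof (intro conjI allI impI ballI)
    show "mono_on {T'..} g"
    proof (rule mono_onI)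
      fix u v assume "u \<in> {T'..}" "v \<in> {T'..}" "u \<le> v"
      then show "g u \<le> g v" using g3 Uinc[of u v] by (cases "u = v") auto
    qed
    fix u assume u: "u \<ge> T'"
    show "lam / \<mu> / real l \<le> g u" using above[of u] gT' u by (cases "u = T'") auto
    show "g u = upper_curve d \<mu> \<beta> l a' u" using g3[OF u] by (simp add: U_def)
    show "g u \<le> \<beta>" using g3[OF u] Uf[OF u] f(3)[of u] u T' by simp
  qed (use T T' gcont gnonneg below above in \<open>auto intro: less_imp_le\<close>)
  have fol: "follows \<mu> lam l f g"
    unfolding follows_def
  proof (intro conjI allI impI)
    fix t :: real assume "t \<ge> 0"
    then show "((\<lambda>u. drift \<mu> lam l (f u) (g u)) has_integral g t) {0..t}"
    proof (intro has_integral_from_zero[where E="{T, T'}", OF gcont])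
      show "g 0 = 0" using g1[of 0] T by simp
      fix u :: real assume u: "u > 0" "u \<notin> {T, T'}"
      then consider "u < T" | "T < u" "u < T'" | "T' < u" by fastforce
      then show "(g has_real_derivative drift \<mu> lam l (f u) (g u)) (at u)"
      proof cases
        case 1
        have "f u \<le> lam / \<mu> / real (l + 1)" using lev u 1 by (auto simp: level_def)
        then have "drift \<mu> lam l (f u) (g u) = 0"
          using drift_waiting[OF \<mu> lam] g1[of u] 1 by simp
        moreover have "(g has_real_derivative 0) (at u)"
          by (rule has_field_derivative_transform_within_open[OF DERIV_const[of 0], of "{..<T}"])
             (use 1 g1 in auto)
        ultimately show ?thesis by simp
      next
        case 2
        have "drift \<mu> lam l (f u) (g u) = \<mu> * (real (l + 1) * f u - lam / \<mu> - g u)"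
          using 2 below[of u] by (intro drift_rising[OF \<mu> lam f(1) l(1)]) auto
        moreover have "(g has_real_derivative
            \<mu> * (real (l + 1) * upper_curve d \<mu> \<beta> (l + 1) a u - lam / \<mu> - A u)) (at u)"
          unfolding A_def
          by (rule has_field_derivative_transform_within_open[OF rise_curve_derivative, of "{T<..<T'}"])
             (use 2 g2 in \<open>auto simp: A_def\<close>)
        ultimately show ?thesis using g2[of u] f(2)[of u] 2 by simp
      next
        case 3
        have "drift \<mu> lam l (f u) (g u) = real (l + 1) * \<mu> * (f u - g u)"
          using 3 above[of u] T' by (intro drift_free[OF \<mu> lam f(1) l(1)]) auto
        moreover have "(g has_real_derivative real (l + 1) * \<mu> * (upper_curve d \<mu> \<beta> (l + 1) a u - U u)) (at u)"
          by (rule has_field_derivative_transform_within_open[OF Uderiv, of "{T'<..}"])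
             (use 3 g3 in auto)
        ultimately show ?thesis using g3[of u] f(2)[of u] 3 T' by simp
      qed
    qed auto
  next
    fix u :: real assume u: "u \<ge> 0" "g u > 0"
    then have "u \<ge> T" using g1[of u] by (cases "u \<le> T") auto
    then show "lam \<le> real (l + 1) * \<mu> * f u"
      using threshold_iff(2)[of \<mu> "real (l + 1)" lam "f u"] f(1)[of u] \<mu> by simp
  qed
  show ?thesis
  proof (rule that[OF lev' T'(1) _ _ _ _ a'l fol])
    show "g u = lam / \<mu> / real l \<longleftrightarrow> u = T'" for u
      using below[of u] above[of u] gT' by (cases u T' rule: linorder_cases) auto
  qed (use g1 g2 a'b in \<open>auto simp: A_def b_def\<close>)
qed

subsection \<open>The two regimes\<close>

text \<open>Here even the constant \<beta> lies below the threshold of component \<open>d\<close>,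
  so every lower component stays in the waiting phase forever.\<close>

lemma overloaded_solution:
  fixes S R :: "nat \<Rightarrow> real \<Rightarrow> real"
  assumes lam: "lam > 0" and \<mu>: "\<mu> > 0" and d: "d \<ge> 2"
    and sol: "gen_skorohod_solution (d - 1) (\<lambda>h. G_functional d \<mu> h \<beta> lam) (P_matrix d) S R"
    and heavy: "lam > real d * \<mu> * \<beta>" and \<beta>: "\<beta> > 0" and u: "u \<ge> 0"
  shows "\<forall>k\<in>{1..d-1}. x_comp d \<mu> \<beta> S k u = 0" "x_comp d \<mu> \<beta> S d u = \<beta>"
proof -
  define C :: "nat \<Rightarrow> real \<Rightarrow> real" where "C k u = (if k = d then \<beta> else 0)" for k u
  have "flow_solution d \<mu> \<beta> lam C (\<lambda>k t. integral {0..t} (\<lambda>u. max 0 (lam - real (k + 1) * \<mu> * C (k + 1) u)))"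
  proof (rule candidate_flow_solution)
    fix k and t :: real assume k: "k \<in> {1..d-1}"
    have "real (k + 1) * \<mu> * (C (k + 1) u - C k u) + max 0 (lam - real (k + 1) * \<mu> * C (k + 1) u)
           - max 0 (lam - real k * \<mu> * C k u) = 0" for u
      using k d lam heavy by (cases "k + 1 = d") (auto simp: C_def)
    then show "((\<lambda>u. real (k + 1) * \<mu> * (C (k + 1) u - C k u) + max 0 (lam - real (k + 1) * \<mu> * C (k + 1) u)
           - max 0 (lam - real k * \<mu> * C k u)) has_integral C k t) {0..t}"
      using k d by (auto simp: C_def)
  qed (use lam d \<beta> in \<open>auto simp: C_def split: if_splits\<close>)
  then have eq: "s_full d \<mu> \<beta> S k u = C k u" if "k \<in> {1..d}" for k
    using flow_solution_unique[OF skorohod_flow_solution[OF sol d] _ d \<mu> that u] by blast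
  have s1: "S 1 u = s_full d \<mu> \<beta> S 1 u" using d by (simp add: s_full_def)
  have zero: "s_full d \<mu> \<beta> S k u = 0" if "k \<in> {1..d-1}" for k
    using eq[of k] that d by (auto simp: C_def)
  show "\<forall>k\<in>{1..d-1}. x_comp d \<mu> \<beta> S k u = 0"
  proof
    fix k assume k: "k \<in> {1..d-1}"
    show "x_comp d \<mu> \<beta> S k u = 0"
    proof (cases "k = 1")
      case True
      then show ?thesis using s1 zero[of 1] d by (simp add: x_comp_def)
    next
      case False
      then have "k - 1 \<in> {1..d-1}" using k by auto
      then show ?thesis using zero[OF k] zero[of "k - 1"] False by (simp add: x_comp_def)
    qed
  qed
  show "x_comp d \<mu> \<beta> S d u = \<beta>"
    using zero[of "d - 1"] eq[of d] d by (auto simp: x_comp_def C_def)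
qed

text \<open>Times, coefficients and curves are only known to exist at each step, so
  \<open>next_level\<close> is iterated by dependent choice. The choice index counts upwards and
  stands for the level \<open>l = d - n\<close>.\<close>

lemma levels_exist:
  assumes lam: "lam > 0" and \<mu>: "\<mu> > 0" and \<beta>: "\<beta> > 0"
    and p: "1 \<le> p" "p + 1 \<le> d" and light: "lam / \<mu> < real (p + 1) * \<beta>"
  obtains T a G where "T d = 0" "\<And>u. G d u = \<beta>"
    "\<And>l. l \<in> {p+1..d} \<Longrightarrow> level d \<mu> \<beta> (lam / \<mu>) l (T l) (a l) (G l)"
    "\<And>l. l \<in> {p+1..d-1} \<Longrightarrow> T (l + 1) < T l"
    "\<And>l u. l \<in> {p+1..d-1} \<Longrightarrow> u \<in> {0..T (l + 1)} \<Longrightarrow> G l u = 0"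
    "\<And>l u. l \<in> {p+1..d-1} \<Longrightarrow> u \<in> {T (l + 1)..T l} \<Longrightarrow>
        G l u = rise_curve d \<mu> \<beta> (lam / \<mu>) l (a (l + 1)) (T (l + 1)) u"
    "\<And>l u. l \<in> {p+1..d-1} \<Longrightarrow> u \<ge> 0 \<Longrightarrow> G l u = lam / \<mu> / real l \<longleftrightarrow> u = T l"
    "\<And>l j. l \<in> {p+1..d-1} \<Longrightarrow> j \<in> {l+2..d} \<Longrightarrow> a l j = real (l + 1) / (real (l + 1) - real j) * a (l + 1) j"
    "\<And>l. l \<in> {p+1..d-1} \<Longrightarrow> a l (l + 1) = exp (real (l + 1) * \<mu> * T l) *
        (1 - lam / \<mu> / (real l * \<beta>) - (\<Sum>k=l+2..d. a l k * exp (- real k * \<mu> * T l)))"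
    "\<And>l. l \<in> {p+1..d-1} \<Longrightarrow> follows \<mu> lam l (G (l + 1)) (G l)"
proof -
  define trans where "trans l T a f T' a' g \<longleftrightarrow> T < T' \<and> (\<forall>u\<in>{0..T}. g u = 0) \<and>
      (\<forall>u\<in>{T..T'}. g u = rise_curve d \<mu> \<beta> (lam / \<mu>) l a T u) \<and>
      (\<forall>u\<ge>0. g u = lam / \<mu> / real l \<longleftrightarrow> u = T') \<and>
      (\<forall>j\<in>{l+2..d}. a' j = real (l + 1) / (real (l + 1) - real j) * a j) \<and>
      a' (l + 1) = exp (real (l + 1) * \<mu> * T') *
        (1 - lam / \<mu> / (real l * \<beta>) - (\<Sum>k=l+2..d. a' k * exp (- real k * \<mu> * T'))) \<and>
      follows \<mu> lam l f g" for l T a f T' a' g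
  define P where "P n st \<longleftrightarrow> (case st of (T, a, g) \<Rightarrow>
      (n = 0 \<longrightarrow> T = 0 \<and> g = (\<lambda>_. \<beta>)) \<and> (n + p + 1 \<le> d \<longrightarrow> level d \<mu> \<beta> (lam / \<mu>) (d - n) T a g))"
    for n and st :: "real \<times> (nat \<Rightarrow> real) \<times> (real \<Rightarrow> real)"
  define Q where "Q n st st' \<longleftrightarrow> (case st of (T, a, f) \<Rightarrow> case st' of (T', a', g) \<Rightarrow>
      n + p + 2 \<le> d \<longrightarrow> trans (d - n - 1) T a f T' a' g)"
    for n and st st' :: "real \<times> (nat \<Rightarrow> real) \<times> (real \<Rightarrow> real)"
  have below: "lam / \<mu> < real l * \<beta>" if "l \<ge> p + 1" for l
  proof -
    have "real (p + 1) * \<beta> \<le> real l * \<beta>" using that \<beta> by (intro mult_right_mono) auto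
    then show ?thesis using light by linarith
  qed
  have "\<exists>F. \<forall>n. P n (F n) \<and> Q n (F n) (F (Suc n))"
  proof (rule dependent_nat_choice)
    have "lam / \<mu> / real d < \<beta>"
      using below[of d] p by (subst pos_divide_less_eq) (auto simp: mult.commute)
    \<comment> \<open>At level \<open>d\<close> the sum in \<open>upper_curve\<close> is empty, so
      the constant \<beta> is an upper curve whatever the coefficients are.\<close>
    then have "level d \<mu> \<beta> (lam / \<mu>) d 0 (\<lambda>_. 0) (\<lambda>_. \<beta>)"
      using \<beta> by (auto simp: level_def upper_curve_def mono_on_def)
    then show "\<exists>st. P 0 st" unfolding P_def by auto
  next
    fix st n assume st: "P n st"
    obtain T a f where [simp]: "st = (T, a, f)" by (cases st)
    show "\<exists>st'. P (Suc n) st' \<and> Q n st st'"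
    proof (cases "n + p + 2 \<le> d")
      case False
      \<comment> \<open>Below level \<open>p + 1\<close> both predicates hold vacuously, and any
        triple continues the sequence.\<close>
      then show ?thesis by (intro exI[of _ "(0, \<lambda>_. 0, \<lambda>_. 0)"]) (auto simp: P_def Q_def)
    next
      case True
      define l where "l = d - Suc n"
      have l: "l \<ge> p + 1" "l + 1 \<le> d" "d - n = l + 1" "d - n - 1 = l" using True by (auto simp: l_def)
      have "level d \<mu> \<beta> (lam / \<mu>) (l + 1) T a f" using st True l by (simp add: P_def)
      moreover have "l \<ge> 1" using l by simp
      ultimately have "\<exists>T' a' g. level d \<mu> \<beta> (lam / \<mu>) l T' a' g \<and> trans l T a f T' a' g"
      proof (rule next_level[OF \<mu> lam \<beta> _ _ l(2) below[OF l(1)]], goal_cases)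
        case (1 T' a' g)
        then have "trans l T a f T' a' g" unfolding trans_def by simp
        with 1(1) show ?case by blast
      qed
      then obtain T' a' g where "level d \<mu> \<beta> (lam / \<mu>) l T' a' g" "trans l T a f T' a' g" by blast
      then show ?thesis
        using l by (intro exI[of _ "(T', a', g)"]) (auto simp: P_def Q_def l_def)
    qed
  qed
  then obtain F where F: "\<And>n. P n (F n)" "\<And>n. Q n (F n) (F (Suc n))" by blast
  define T where "T l = fst (F (d - l))" for l
  define a where "a l = fst (snd (F (d - l)))" for l
  define G where "G l = snd (snd (F (d - l)))" for l
  have Fl: "F (d - l) = (T l, a l, G l)" for l by (simp add: T_def a_def G_def)
  have lev: "level d \<mu> \<beta> (lam / \<mu>) l (T l) (a l) (G l)" if "l \<in> {p+1..d}" for l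
  proof -
    have "d - l + p + 1 \<le> d" "d - (d - l) = l" using that by auto
    then show ?thesis using F(1)[of "d - l"] unfolding Fl by (simp add: P_def)
  qed
  have tr: "trans l (T (l + 1)) (a (l + 1)) (G (l + 1)) (T l) (a l) (G l)" if l: "l \<in> {p+1..d-1}" for l
  proof -
    have n: "Suc (d - (l + 1)) = d - l" "d - (l + 1) + p + 2 \<le> d" "d - (d - (l + 1)) - 1 = l"
      using l by auto
    show ?thesis using F(2)[of "d - (l + 1)"] unfolding n(1) Fl Q_def using n by simp
  qed
  have init: "T d = 0" "G d u = \<beta>" for u using F(1)[of 0] Fl[of d] by (auto simp: P_def)
  show ?thesis
  proof (rule that[OF init lev], goal_cases)
    case (2 l)
    then show ?case using tr[of l] unfolding trans_def by simp
  next
    case (3 l u)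
    then show ?case using tr[of l] unfolding trans_def by simp
  next
    case (4 l u)
    then show ?case using tr[of l] unfolding trans_def by simp
  next
    case (5 l u)
    then show ?case using tr[of l] unfolding trans_def by simp
  next
    case (6 l j)
    then show ?case using tr[of l] unfolding trans_def by simp
  next
    case (7 l)
    then show ?case using tr[of l] unfolding trans_def by simp
  next
    case (8 l)
    then show ?case using tr[of l] unfolding trans_def by simp
  qed
qed

text \<open>The phase \<open>l = p\<close> has no right end and \<open>T p\<close> has no meaning,
  so the bound \<open>u \<le> T l\<close> is imposed only for \<open>l > p\<close>.\<close>

lemma stable_solution:
  fixes S R :: "nat \<Rightarrow> real \<Rightarrow> real"
  assumes lam: "lam > 0" and \<mu>: "\<mu> > 0" and \<beta>: "\<beta> > 0" and d: "d \<ge> 2"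
    and sol: "gen_skorohod_solution (d - 1) (\<lambda>h. G_functional d \<mu> h \<beta> lam) (P_matrix d) S R"
    and p: "2 \<le> p" "p + 1 \<le> d" "real p * \<beta> \<le> lam / \<mu>" "lam / \<mu> < real (p + 1) * \<beta>"
  obtains T a where "T d = 0"
    "\<And>l. l \<in> {p+1..d-1} \<Longrightarrow> T (l + 1) < T l"
    "\<And>l k u. l \<in> {p..d-1} \<Longrightarrow> T (l + 1) \<le> u \<Longrightarrow> l > p \<Longrightarrow> u \<le> T l \<Longrightarrow> k \<in> {1..l-1} \<Longrightarrow> s_full d \<mu> \<beta> S k u = 0"
    "\<And>k u. T (p + 1) \<le> u \<Longrightarrow> k \<in> {1..p-1} \<Longrightarrow> s_full d \<mu> \<beta> S k u = 0"
    "\<And>l u. l \<in> {p..d-1} \<Longrightarrow> T (l + 1) \<le> u \<Longrightarrow> (l > p \<Longrightarrow> u \<le> T l) \<Longrightarrow>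
        s_full d \<mu> \<beta> S l u = rise_curve d \<mu> \<beta> (lam / \<mu>) l (a (l + 1)) (T (l + 1)) u"
    "\<And>l k u. l \<in> {p..d-1} \<Longrightarrow> T (l + 1) \<le> u \<Longrightarrow> k \<in> {l+1..d} \<Longrightarrow>
        s_full d \<mu> \<beta> S k u = upper_curve d \<mu> \<beta> k (a k) u"
    "\<And>l u. l \<in> {p+1..d-1} \<Longrightarrow> u \<ge> 0 \<Longrightarrow> s_full d \<mu> \<beta> S l u = lam / \<mu> / real l \<longleftrightarrow> u = T l"
    "\<And>l j. l \<in> {p+1..d-1} \<Longrightarrow> j \<in> {l+2..d} \<Longrightarrow> a l j = real (l + 1) / (real (l + 1) - real j) * a (l + 1) j"
    "\<And>l. l \<in> {p+1..d-1} \<Longrightarrow> a l (l + 1) = exp (real (l + 1) * \<mu> * T l) *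
        (1 - lam / \<mu> / (real l * \<beta>) - (\<Sum>k=l+2..d. a l k * exp (- real k * \<mu> * T l)))"
proof -
  have p1: "1 \<le> p" using p by simp
  obtain T a G where Td: "T d = 0" and Gd: "\<And>u. G d u = \<beta>"
    and lev: "\<And>l. l \<in> {p+1..d} \<Longrightarrow> level d \<mu> \<beta> (lam / \<mu>) l (T l) (a l) (G l)"
    and Tdec: "\<And>l. l \<in> {p+1..d-1} \<Longrightarrow> T (l + 1) < T l"
    and G0: "\<And>l u. l \<in> {p+1..d-1} \<Longrightarrow> u \<in> {0..T (l + 1)} \<Longrightarrow> G l u = 0"
    and G1: "\<And>l u. l \<in> {p+1..d-1} \<Longrightarrow> u \<in> {T (l + 1)..T l} \<Longrightarrow>
        G l u = rise_curve d \<mu> \<beta> (lam / \<mu>) l (a (l + 1)) (T (l + 1)) u"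
    and hit: "\<And>l u. l \<in> {p+1..d-1} \<Longrightarrow> u \<ge> 0 \<Longrightarrow> G l u = lam / \<mu> / real l \<longleftrightarrow> u = T l"
    and rec: "\<And>l j. l \<in> {p+1..d-1} \<Longrightarrow> j \<in> {l+2..d} \<Longrightarrow> a l j = real (l + 1) / (real (l + 1) - real j) * a (l + 1) j"
    and rec1: "\<And>l. l \<in> {p+1..d-1} \<Longrightarrow> a l (l + 1) = exp (real (l + 1) * \<mu> * T l) *
        (1 - lam / \<mu> / (real l * \<beta>) - (\<Sum>k=l+2..d. a l k * exp (- real k * \<mu> * T l)))"
    and fol: "\<And>l. l \<in> {p+1..d-1} \<Longrightarrow> follows \<mu> lam l (G (l + 1)) (G l)"
  proof (rule levels_exist[OF lam \<mu> \<beta> p1 p(2,4)], goal_cases)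
    case (1 T a G)
    show ?case by (rule 1(1)[OF 1(2-)])
  qed
  have top: "p + 1 \<in> {p+1..d}" using p by simp
  obtain g where g: "continuous_on {0..} g" "\<And>u. u \<ge> 0 \<Longrightarrow> 0 \<le> g u"
    "\<And>u. u \<in> {0..T (p + 1)} \<Longrightarrow> g u = 0"
    "\<And>u. u \<ge> T (p + 1) \<Longrightarrow> g u = rise_curve d \<mu> \<beta> (lam / \<mu>) p (a (p + 1)) (T (p + 1)) u"
    "\<And>u. u \<ge> 0 \<Longrightarrow> g u \<le> lam / \<mu> / real p" "follows \<mu> lam p (G (p + 1)) g"
  proof (rule last_level[OF \<mu> lam lev[OF top] p1 p(3)], goal_cases)
    case (1 g)
    show ?case by (rule 1(1)[OF 1(2-)])
  qed
  define C where "C k = (if k < p then (\<lambda>_. 0) else if k = p then g else G k)" for k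
  have Cfol: "follows \<mu> lam k (C (k + 1)) (C k)" if k: "k \<in> {1..d-1}" for k
  proof -
    consider "k < p" | "k = p" | "k > p" by linarith
    then show ?thesis
    proof cases
      case 1
      \<comment> \<open>Component \<open>k + 1\<close> is \<open>0\<close> or \<open>g\<close>, and
        neither exceeds its threshold, so component \<open>k\<close> waits forever.\<close>
      have "C (k + 1) u \<le> lam / \<mu> / real (k + 1)" if "u \<ge> 0" for u
        using 1 lam \<mu> g(5)[OF that] by (cases "k + 1 = p") (auto simp: C_def)
      then have "drift \<mu> lam k (C (k + 1) u) (C k u) = 0" if "u \<ge> 0" for u
        using drift_waiting[OF \<mu> lam] 1 that by (simp add: C_def)
      then have "((\<lambda>u. drift \<mu> lam k (C (k + 1) u) (C k u)) has_integral 0) {0..t}" for t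
        by (intro has_integral_is_0) auto
      then show ?thesis using 1 unfolding follows_def by (simp add: C_def)
    next
      case 2
      then show ?thesis using g(6) by (simp add: C_def)
    next
      case 3
      then show ?thesis using fol[of k] k by (simp add: C_def)
    qed
  qed
  have flow: "flow_solution d \<mu> \<beta> lam C (\<lambda>k t. integral {0..t} (\<lambda>u. max 0 (lam - real (k + 1) * \<mu> * C (k + 1) u)))"
  proof (rule candidate_flow_solution[OF d])
    show "continuous_on {0..} (C k)" if "k \<in> {1..d}" for k
      using lev[of k] g(1) that by (auto simp: C_def level_def)
    show "C k u \<ge> 0" if "k \<in> {1..d-1}" "u \<ge> 0" for k u
      using lev[of k] g(2)[of u] that by (auto simp: C_def level_def)
    show "lam \<le> real (k + 1) * \<mu> * C (k + 1) u" if "k \<in> {1..d-1}" "u \<ge> 0" "C k u > 0" for k u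
      using Cfol[OF that(1)] that unfolding follows_def by blast
    show "((\<lambda>u. real (k + 1) * \<mu> * (C (k + 1) u - C k u) + max 0 (lam - real (k + 1) * \<mu> * C (k + 1) u)
           - max 0 (lam - real k * \<mu> * C k u)) has_integral C k t) {0..t}" if "k \<in> {1..d-1}" "t \<ge> 0" for k t
      using Cfol[OF that(1)] that unfolding follows_def drift_def by blast
    \<comment> \<open>\<open>2 \<le> p\<close> puts component \<open>1\<close> among the vanishing
      ones; this is where the lower bound on the load enters.\<close>
    show "C 1 u = 0" for u using p by (simp add: C_def)
    show "C d u = \<beta>" for u using p Gd by (simp add: C_def)
  qed (use lam in auto)
  have sC: "s_full d \<mu> \<beta> S k u = C k u" if "k \<in> {1..d}" "u \<ge> 0" for k u
    using flow_solution_unique[OF skorohod_flow_solution[OF sol d] flow d \<mu> that] .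
  have Tanti: "T k \<le> T l" if "p + 1 \<le> l" "l \<le> k" "k \<le> d" for k l
    using that(2,3,1)
  proof (induction k rule: dec_induct)
    case (step n)
    then have "T (n + 1) < T n" by (intro Tdec) auto
    then show ?case using step by auto
  qed simp
  have Tpos: "T l \<ge> 0" if "l \<in> {p+1..d}" for l using lev[OF that] by (simp add: level_def)
  have dn: "l + 1 \<in> {p+1..d}" if "l \<in> {p..d-1}" for l using that p by auto
  have zero: "C k u = 0" if "l \<in> {p..d-1}" "T (l + 1) \<le> u" "l > p \<Longrightarrow> u \<le> T l" "k \<in> {1..l-1}" for l k u
  proof -
    have kl: "k < l" "l \<le> d" using that(1,4) by auto
    have u: "u \<ge> 0" using Tpos[OF dn[OF that(1)]] that(2) by linarith
    \<comment> \<open>As \<open>T\<close> decreases in its index,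
      \<open>u \<le> T l \<le> T (k + 1)\<close>: component \<open>k\<close> has not started when
      \<open>k \<ge> p\<close>. Components below \<open>p\<close> vanish by definition.\<close>
    from kl(1) consider "k < p" | "k = p" "l > p" | "k > p" "l > p" by linarith
    then show ?thesis
    proof cases
      case 2
      then have "u \<le> T (p + 1)" using Tanti[of "p + 1" l] that(3) kl by auto
      then show ?thesis using 2 g(3)[of u] u by (simp add: C_def)
    next
      case 3
      then have "u \<le> T (k + 1)" using Tanti[of "k + 1" l] that(3) kl by auto
      moreover have "k \<in> {p+1..d-1}" using 3 kl by auto
      ultimately show ?thesis using 3 G0[of k u] u by (simp add: C_def)
    qed (simp add: C_def)
  qed
  show ?thesis
  proof (rule that[of T a, OF Td Tdec _ _ _ _ _ rec rec1])
    fix l k u assume *: "l \<in> {p..d-1}" "T (l + 1) \<le> u" "l > p" "u \<le> T l" "k \<in> {1..l-1}"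
    then show "s_full d \<mu> \<beta> S k u = 0"
      using zero[OF *(1,2,4,5)] sC[of k u] Tpos[OF dn[OF *(1)]] by auto
  next
    fix k u assume *: "T (p + 1) \<le> u" "k \<in> {1..p-1}"
    have "p \<in> {p..d-1}" using p by auto
    then show "s_full d \<mu> \<beta> S k u = 0"
      using zero[of p u k] sC[of k u] Tpos[OF dn[of p]] * p by auto
  next
    fix l u assume *: "l \<in> {p..d-1}" "T (l + 1) \<le> u" "l > p \<Longrightarrow> u \<le> T l"
    have "u \<ge> 0" using Tpos[OF dn[OF *(1)]] * by linarith
    then have "s_full d \<mu> \<beta> S l u = C l u" using * p by (intro sC) auto
    then show "s_full d \<mu> \<beta> S l u = rise_curve d \<mu> \<beta> (lam / \<mu>) l (a (l + 1)) (T (l + 1)) u"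
      using g(4)[of u] G1[of l u] * by (cases "l = p") (auto simp: C_def)
  next
    fix l k u assume *: "l \<in> {p..d-1}" "T (l + 1) \<le> u" "k \<in> {l+1..d}"
    have "u \<ge> 0" using Tpos[OF dn[OF *(1)]] * by linarith
    then have "s_full d \<mu> \<beta> S k u = G k u" using * p by (subst sC) (auto simp: C_def)
    moreover have "T k \<le> u" using Tanti[of "l + 1" k] * by auto
    ultimately show "s_full d \<mu> \<beta> S k u = upper_curve d \<mu> \<beta> k (a k) u"
      using lev[of k] * by (auto simp: level_def)
  next
    fix l u assume *: "l \<in> {p+1..d-1}" "(0::real) \<le> u"
    then have "s_full d \<mu> \<beta> S l u = G l u" by (subst sC) (auto simp: C_def)
    then show "s_full d \<mu> \<beta> S l u = lam / \<mu> / real l \<longleftrightarrow> u = T l" using hit[OF *] by simp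
  qed
qed

theorem proposition1:
  fixes lam \<mu> \<beta> \<rho> :: real and d :: nat and S R s x :: "nat \<Rightarrow> real \<Rightarrow> real"
  assumes "lam > 0" and "\<mu> > 0" and "\<beta> > 0" and "d \<ge> 2"
    and "gen_skorohod_solution (d - 1) (\<lambda>h. G_functional d \<mu> h \<beta> lam) (P_matrix d) S R"
  defines "\<rho> \<equiv> lam / \<mu>"
    and "s \<equiv> s_full d \<mu> \<beta> S"
    and "x \<equiv> x_comp d \<mu> \<beta> S"
  shows
    "(2 * \<mu> * \<beta> < lam \<and> lam < real d * \<mu> * \<beta> \<longrightarrow>
       (\<forall>p. p = nat \<lfloor>\<rho> / \<beta>\<rfloor> \<longrightarrow>
        (\<exists>(t :: nat \<Rightarrow> ereal) (\<alpha> :: nat \<Rightarrow> nat \<Rightarrow> real) (\<xi> :: nat \<Rightarrow> nat \<Rightarrow> real).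
          t d = 0 \<and> t p = \<infinity> \<and> (\<forall>l\<in>{p..d-1}. t (l + 1) < t l) \<and>
          (\<forall>l\<in>{p..d-1}. \<forall>u::real. t (l + 1) \<le> ereal u \<and> ereal u \<le> t l \<longrightarrow>
             (\<forall>k\<in>{1..l-1}. s k u = 0) \<and>
             s l u = real (l + 1) * \<beta> - \<rho> + \<xi> l 1 * exp (- \<mu> * u)
                       + (\<Sum>i=l+2..d. \<xi> l i * exp (- \<mu> * real i * u)) \<and>
             (\<forall>k\<in>{l+1..d}. s k u = \<beta> * (1 - (\<Sum>i=k+1..d. \<alpha> k i * exp (- real i * \<mu> * u))))) \<and>
          (\<forall>l\<in>{p+1..d-1}.
             (\<forall>j\<in>{l+2..d}.
                \<alpha> l j = real (l + 1) / (real (l + 1) - real j) * \<alpha> (l + 1) j) \<and>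
             \<alpha> l (l + 1) = exp (real (l + 1) * \<mu> * real_of_ereal (t l)) *
               (1 - \<rho> / (real l * \<beta>)
                  - (\<Sum>k=l+2..d. \<alpha> l k * exp (- real k * \<mu> * real_of_ereal (t l))))) \<and>
          (\<forall>l\<in>{p..d-1}.
             (\<forall>j\<in>{l+2..d}. \<xi> l j = \<beta> * real (l + 1) / (real j - 1) * \<alpha> (l + 1) j) \<and>
             \<xi> l 1 = - ((real (l + 1) * \<beta> - \<rho>) * exp (\<mu> * real_of_ereal (t (l + 1)))
               + (\<Sum>j=l+2..d. \<xi> l j * exp (- \<mu> * (real j - 1) * real_of_ereal (t (l + 1)))))) \<and>
          (\<forall>l\<in>{p+1..d-1}. \<forall>u\<ge>0.
             s l u = lam / (real l * \<mu>) \<longleftrightarrow> ereal u = t l)))) \<and>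
     (lam > real d * \<mu> * \<beta> \<longrightarrow>
       (\<forall>u\<ge>0. (\<forall>k\<in>{1..d-1}. x k u = 0) \<and> x d u = \<beta>))"
proof (intro conjI impI allI)
  fix u :: real assume "real d * \<mu> * \<beta> < lam" "0 \<le> u"
  then show "\<forall>k\<in>{1..d-1}. x k u = 0" "x d u = \<beta>"
    unfolding x_def using overloaded_solution[OF assms(1,2,4,5) _ assms(3)] by blast+
next
  fix p assume load: "2 * \<mu> * \<beta> < lam \<and> lam < real d * \<mu> * \<beta>" and "p = nat \<lfloor>\<rho> / \<beta>\<rfloor>"
  have ratio: "2 < \<rho> / \<beta>" "\<rho> / \<beta> < real d"
    using load assms(2,3) by (auto simp: \<rho>_def field_simps)
  \<comment> \<open>The lower load bound gives \<open>p \<ge> 2\<close>, so that \<open>s 1\<close>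
    stays at \<open>0\<close>; the upper one gives \<open>p < d\<close>, so that at least one
    component rises.\<close>
  have fl: "2 \<le> \<lfloor>\<rho> / \<beta>\<rfloor>" "\<lfloor>\<rho> / \<beta>\<rfloor> < int d"
    using ratio by (auto simp: le_floor_iff floor_less_iff)
  have pf: "int p = \<lfloor>\<rho> / \<beta>\<rfloor>" using fl \<open>p = _\<close> by simp
  have "real p \<le> \<rho> / \<beta>" "\<rho> / \<beta> < real (p + 1)"
    using pf by linarith+
  moreover have "2 \<le> p" "p + 1 \<le> d" using pf fl by linarith+
  ultimately have p: "2 \<le> p" "p + 1 \<le> d" "real p * \<beta> \<le> lam / \<mu>" "lam / \<mu> < real (p + 1) * \<beta>"
    using assms(3) unfolding \<rho>_def[symmetric]
    by (auto simp: pos_le_divide_eq pos_divide_less_eq)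
  obtain T a where Td: "T d = 0"
    and Tdec: "\<And>l. l \<in> {p+1..d-1} \<Longrightarrow> T (l + 1) < T l"
    and zero: "\<And>l k u. l \<in> {p..d-1} \<Longrightarrow> T (l + 1) \<le> u \<Longrightarrow> l > p \<Longrightarrow> u \<le> T l \<Longrightarrow> k \<in> {1..l-1} \<Longrightarrow> s k u = 0"
    and zero': "\<And>k u. T (p + 1) \<le> u \<Longrightarrow> k \<in> {1..p-1} \<Longrightarrow> s k u = 0"
    and rise: "\<And>l u. l \<in> {p..d-1} \<Longrightarrow> T (l + 1) \<le> u \<Longrightarrow> (l > p \<Longrightarrow> u \<le> T l) \<Longrightarrow>
        s l u = rise_curve d \<mu> \<beta> \<rho> l (a (l + 1)) (T (l + 1)) u"
    and upper: "\<And>l k u. l \<in> {p..d-1} \<Longrightarrow> T (l + 1) \<le> u \<Longrightarrow> k \<in> {l+1..d} \<Longrightarrow>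
        s k u = upper_curve d \<mu> \<beta> k (a k) u"
    and hit: "\<And>l u. l \<in> {p+1..d-1} \<Longrightarrow> u \<ge> 0 \<Longrightarrow> s l u = \<rho> / real l \<longleftrightarrow> u = T l"
    and rec: "\<And>l j. l \<in> {p+1..d-1} \<Longrightarrow> j \<in> {l+2..d} \<Longrightarrow> a l j = real (l + 1) / (real (l + 1) - real j) * a (l + 1) j"
    and rec1: "\<And>l. l \<in> {p+1..d-1} \<Longrightarrow> a l (l + 1) = exp (real (l + 1) * \<mu> * T l) *
        (1 - \<rho> / (real l * \<beta>) - (\<Sum>k=l+2..d. a l k * exp (- real k * \<mu> * T l)))"
  proof (rule stable_solution[OF assms(1-5) p], goal_cases)
    case (1 T a)
    show ?case by (rule 1(1)[OF 1(2-)[folded s_def \<rho>_def]])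
  qed
  \<comment> \<open>The value \<infinity> at \<open>p\<close> encodes the unbounded last phase; all
    formulas evaluate \<open>t\<close> at indices above \<open>p\<close>, where it is
    finite.\<close>
  define t where "t l = (if l \<le> p then \<infinity> else ereal (T l))" for l
  have tr: "t l = ereal (T l)" if "l \<ge> p + 1" for l using that by (simp add: t_def)
  define \<xi> where "\<xi> l = rise_coeff d \<mu> \<beta> \<rho> l (a (l + 1)) (T (l + 1))" for l
  have \<xi>j: "\<xi> l j = \<beta> * real (l + 1) / (real j - 1) * a (l + 1) j" if "j \<in> {l+2..d}" for l j
    using that unfolding \<xi>_def rise_coeff_def by auto
  have inphase: "T (l + 1) \<le> u" "l > p \<Longrightarrow> u \<le> T l"
    if "l \<in> {p..d-1}" "t (l + 1) \<le> ereal u \<and> ereal u \<le> t l" for l u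
    using that tr[of "l + 1"] tr[of l] by auto
  show "\<exists>(t :: nat \<Rightarrow> ereal) (\<alpha> :: nat \<Rightarrow> nat \<Rightarrow> real) (\<xi> :: nat \<Rightarrow> nat \<Rightarrow> real).
          t d = 0 \<and> t p = \<infinity> \<and> (\<forall>l\<in>{p..d-1}. t (l + 1) < t l) \<and>
          (\<forall>l\<in>{p..d-1}. \<forall>u::real. t (l + 1) \<le> ereal u \<and> ereal u \<le> t l \<longrightarrow>
             (\<forall>k\<in>{1..l-1}. s k u = 0) \<and>
             s l u = real (l + 1) * \<beta> - \<rho> + \<xi> l 1 * exp (- \<mu> * u)
                       + (\<Sum>i=l+2..d. \<xi> l i * exp (- \<mu> * real i * u)) \<and>
             (\<forall>k\<in>{l+1..d}. s k u = \<beta> * (1 - (\<Sum>i=k+1..d. \<alpha> k i * exp (- real i * \<mu> * u))))) \<and>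
          (\<forall>l\<in>{p+1..d-1}.
             (\<forall>j\<in>{l+2..d}.
                \<alpha> l j = real (l + 1) / (real (l + 1) - real j) * \<alpha> (l + 1) j) \<and>
             \<alpha> l (l + 1) = exp (real (l + 1) * \<mu> * real_of_ereal (t l)) *
               (1 - \<rho> / (real l * \<beta>)
                  - (\<Sum>k=l+2..d. \<alpha> l k * exp (- real k * \<mu> * real_of_ereal (t l))))) \<and>
          (\<forall>l\<in>{p..d-1}.
             (\<forall>j\<in>{l+2..d}. \<xi> l j = \<beta> * real (l + 1) / (real j - 1) * \<alpha> (l + 1) j) \<and>
             \<xi> l 1 = - ((real (l + 1) * \<beta> - \<rho>) * exp (\<mu> * real_of_ereal (t (l + 1)))
               + (\<Sum>j=l+2..d. \<xi> l j * exp (- \<mu> * (real j - 1) * real_of_ereal (t (l + 1)))))) \<and>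
          (\<forall>l\<in>{p+1..d-1}. \<forall>u\<ge>0.
             s l u = lam / (real l * \<mu>) \<longleftrightarrow> ereal u = t l)"
  proof (rule exI[of _ t], rule exI[of _ a], rule exI[of _ \<xi>], intro conjI ballI allI impI)
    show "t d = 0" using tr[of d] p Td by simp
    show "t p = \<infinity>" by (simp add: t_def)
    show "t (l + 1) < t l" if "l \<in> {p..d-1}" for l
      using Tdec[of l] that by (cases "l = p") (auto simp: t_def)
  next
    fix l u assume l: "l \<in> {p..d-1}" and u: "t (l + 1) \<le> ereal u \<and> ereal u \<le> t l"
    note ph = inphase[OF l u]
    show "s k u = 0" if "k \<in> {1..l-1}" for k
      using zero[OF l ph(1) _ ph(2) that] zero'[of u k] ph that l by (cases "l = p") auto
    have "s l u = rise_curve d \<mu> \<beta> \<rho> l (a (l + 1)) (T (l + 1)) u"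
      by (rule rise[OF l]) (use ph in auto)
    then show "s l u = real (l + 1) * \<beta> - \<rho> + \<xi> l 1 * exp (- \<mu> * u)
                       + (\<Sum>i=l+2..d. \<xi> l i * exp (- \<mu> * real i * u))"
      unfolding rise_curve_def \<xi>_def .
    show "s k u = \<beta> * (1 - (\<Sum>i=k+1..d. a k i * exp (- real i * \<mu> * u)))" if "k \<in> {l+1..d}" for k
      using upper[OF l ph(1) that] unfolding upper_curve_def .
  next
    fix l assume l: "l \<in> {p+1..d-1}"
    then have tl: "real_of_ereal (t l) = T l" using tr[of l] by simp
    show "a l j = real (l + 1) / (real (l + 1) - real j) * a (l + 1) j" if "j \<in> {l+2..d}" for j
      using rec[OF l that] .
    show "a l (l + 1) = exp (real (l + 1) * \<mu> * real_of_ereal (t l)) *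
               (1 - \<rho> / (real l * \<beta>)
                  - (\<Sum>k=l+2..d. a l k * exp (- real k * \<mu> * real_of_ereal (t l))))"
      using rec1[OF l] unfolding tl .
    show "s l u = lam / (real l * \<mu>) \<longleftrightarrow> ereal u = t l" if "u \<ge> 0" for u
      using hit[OF l that] tr[of l] l by (simp add: \<rho>_def mult.commute)
  next
    fix l assume l: "l \<in> {p..d-1}"
    then have tl: "real_of_ereal (t (l + 1)) = T (l + 1)" using tr[of "l + 1"] by simp
    show "\<xi> l j = \<beta> * real (l + 1) / (real j - 1) * a (l + 1) j" if "j \<in> {l+2..d}" for j
      using \<xi>j[OF that] .
    have "(\<Sum>j=l+2..d. \<xi> l j * exp (- \<mu> * (real j - 1) * T (l + 1)))
      = (\<Sum>j=l+2..d. \<beta> * real (l + 1) / (real j - 1) * a (l + 1) j * exp (- \<mu> * (real j - 1) * T (l + 1)))"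
      by (rule sum.cong) (simp_all add: \<xi>j)
    then show "\<xi> l 1 = - ((real (l + 1) * \<beta> - \<rho>) * exp (\<mu> * real_of_ereal (t (l + 1)))
               + (\<Sum>j=l+2..d. \<xi> l j * exp (- \<mu> * (real j - 1) * real_of_ereal (t (l + 1)))))"
      unfolding tl by (simp only: \<xi>_def[of l] rise_coeff_def[of _ _ _ _ _ _ _ 1] if_True simp_thms)
  qed
qed

end
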